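(* Suppose that $f(\cdot;\xi)$ is convex and $L$-smooth for every realization of $\xi$ (with $L>0$), that $F$ has a minimizer $w_*$, and that there is $\sigma_*>0$ with $\mathbb{E}[\|\nabla f(w_*;\xi)\|^2]\le\sigma_*^2$. Let $w_0\in\mathbb{R}^d$ be given, and let $\tilde w$ be the output of iSARAH-IN$(w_0,\eta,m,b)$ with $\eta=\frac{1}{L\sqrt{m+1}}\le \frac1L$ and $b=2\sqrt{m+1}$, where $m\ge 1$ is such that $2\sqrt{m+1}$ is an integer. Then $$\mathbb{E}[\|\nabla F(\tilde w)\|^2]\le \frac{1}{\sqrt{m+1}}\left[6L\,[F(w_0)-F(w_* )]+2\sigma_*^2\right].$$
   Context: $\xi$ is a random variable; for each realization, $f(\cdot;\xi):\mathbb{R}^d\to\mathbb{R}$ is differentiable; $F(w)=\mathbb{E}[f(w;\xi)]$ is bounded below, and $\mathbb{E}[\nabla f(w;\xi)]=\nabla F(w)$ for every fixed $w\in\mathbb{R}^d$. $\|\cdot\|$ is the Euclidean norm. $L$-smooth for every realization means $\|\nabla f(w;\xi)-\nabla f(w';\xi)\|\le L\|w-w'\|$ for all $w,w'\in\mathbb{R}^d$ and every realization of $\xi$. The procedure iSARAH-IN$(w_0,\eta,m,b)$ (inner loop of the inexact SARAH algorithm) has parameters $\eta>0$ and positive integers $m,b$. Let $\zeta_1,\dots,\zeta_b,\xi_1,\xi_2,\dots$ be i.i.d. copies of $\xi$, independent of $w_0$. Set $$v_0=\frac1b\sum_{i=1}^b\nabla f(w_0;\zeta_i),\qquad w_1=w_0-\eta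 v_0,$$ and for $t\ge 1$ $$v_t=\nabla f(w_t;\xi_t)-\nabla f(w_{t-1};\xi_t)+v_{t-1},\qquad w_{t+1}=w_t-\eta v_t.$$ The output is $\tilde w=w_t$ with $t$ chosen uniformly at random from $\{0,1,\dots,m\}$, independently of everything else (only $w_0,\dots,w_m$ are needed to produce the output). *)

theory Defs
  imports "HOL-Probability.Probability"
begin

definition gradient :: "('a::real_inner \<Rightarrow> real) \<Rightarrow> 'a \<Rightarrow> 'a" where
  "gradient g w = (THE D. GDERIV g w :> D)"

lemma gradient_eqI:
  assumes "GDERIV g w :> D"
  shows "gradient g w = D"
  unfolding gradient_def
proof (rule the_equality)
  fix D' assume "GDERIV g w :> D'"
  with assms have "(\<lambda>h. inner h D') = (\<lambda>h. inner h D)"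
    unfolding gderiv_def by (rule has_derivative_unique[rotated])
  then have "inner (D' - D) D' = inner (D' - D) D"
    by (rule fun_cong)
  then have "inner (D' - D) (D' - D) = 0"
    by (simp add: inner_diff_right)
  then show "D' = D" by simp
qed (fact assms)

text \<open>Differentiability of \<open>g\<close> is assumed separately wherever this notion is used.\<close>

definition smooth :: "real \<Rightarrow> ('a::real_inner \<Rightarrow> real) \<Rightarrow> bool" where
  "smooth L g \<longleftrightarrow> (\<forall>w w'. norm (gradient g w - gradient g w') \<le> L * norm (w - w'))"

text \<open>
  One run of the algorithm along fixed samples: \<open>f s\<close> is the loss function for the
  realization \<open>s\<close>, the mini-batch is \<open>z 1, \<dots>, z b\<close>, and \<open>x t\<close> is the sample drawn in
  step \<open>t \<ge> 1\<close>; the values \<open>z 0\<close> and \<open>x 0\<close> are never used.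
\<close>

function isarah_w :: "('s \<Rightarrow> 'a::real_inner \<Rightarrow> real) \<Rightarrow> 'a \<Rightarrow> real \<Rightarrow> nat
      \<Rightarrow> (nat \<Rightarrow> 's) \<Rightarrow> (nat \<Rightarrow> 's) \<Rightarrow> nat \<Rightarrow> 'a"
  and isarah_v :: "('s \<Rightarrow> 'a::real_inner \<Rightarrow> real) \<Rightarrow> 'a \<Rightarrow> real \<Rightarrow> nat
      \<Rightarrow> (nat \<Rightarrow> 's) \<Rightarrow> (nat \<Rightarrow> 's) \<Rightarrow> nat \<Rightarrow> 'a" where
  "isarah_w f w0 \<eta> b z x 0 = w0"
| "isarah_w f w0 \<eta> b z x (Suc t) = isarah_w f w0 \<eta> b z x t - \<eta> *\<^sub>R isarah_v f w0 \<eta> b z x t"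
| "isarah_v f w0 \<eta> b z x 0 = (1 / real b) *\<^sub>R (\<Sum>i = 1..b. gradient (f (z i)) w0)"
| "isarah_v f w0 \<eta> b z x (Suc t) =
     gradient (f (x (Suc t))) (isarah_w f w0 \<eta> b z x (Suc t))
     - gradient (f (x (Suc t))) (isarah_w f w0 \<eta> b z x t)
     + isarah_v f w0 \<eta> b z x t"
  by pat_completeness auto
termination
  by (relation "Wellfounded.measure (\<lambda>p. case p of
        Inl (f, w0, \<eta>, b, z, x, t) \<Rightarrow> 2 * t
      | Inr (f, w0, \<eta>, b, z, x, t) \<Rightarrow> 2 * t + 1)") auto

text \<open>
  \<open>indep_var\<close> requires both random variables to take values in the same type; this is
  the same notion (cf. \<open>indep_var_eq\<close>) without that restriction.
\<close>

definition (in prob_space) indep_rvs ::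
    "'b measure \<Rightarrow> ('a \<Rightarrow> 'b) \<Rightarrow> 'c measure \<Rightarrow> ('a \<Rightarrow> 'c) \<Rightarrow> bool" where
  "indep_rvs S X T Y \<longleftrightarrow>
     random_variable S X \<and> random_variable T Y \<and>
     indep_set {X -` A \<inter> space M | A. A \<in> sets S} {Y -` B \<inter> space M | B. B \<in> sets T}"

text \<open>
  The random input of one run on \<open>M\<close>, where \<open>D\<close> is the law of \<open>\<xi>\<close>: the samples \<open>\<zeta> 1, \<dots>, \<zeta> b\<close>
  and \<open>\<xi> 1, \<xi> 2, \<dots>\<close> are i.i.d. with law \<open>D\<close>, and the output index \<open>\<tau>\<close> is uniform on
  \<open>{0..m}\<close> and independent of all of them.
\<close>

definition isarah_sampling :: "'o measure \<Rightarrow> 's measure \<Rightarrow> nat \<Rightarrow> nat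
    \<Rightarrow> (nat \<Rightarrow> 'o \<Rightarrow> 's) \<Rightarrow> (nat \<Rightarrow> 'o \<Rightarrow> 's) \<Rightarrow> ('o \<Rightarrow> nat) \<Rightarrow> bool" where
  "isarah_sampling M D m b \<zeta> \<xi> \<tau> \<longleftrightarrow>
     prob_space M \<and>
     prob_space.indep_vars M (\<lambda>_. D) (case_sum \<zeta> \<xi>) ({1..b} <+> {1..}) \<and>
     (\<forall>i\<in>{1..b}. distr M D (\<zeta> i) = D) \<and>
     (\<forall>t\<ge>1. distr M D (\<xi> t) = D) \<and>
     distr M (count_space UNIV) \<tau> = measure_pmf (pmf_of_set {0..m}) \<and>
     prob_space.indep_rvs M
       (count_space UNIV) \<tau>
       (\<Pi>\<^sub>M j \<in> {1..b} <+> {1..}. D) (\<lambda>\<omega>. \<lambda>j \<in> {1..b} <+> {1..}. case_sum \<zeta> \<xi> j \<omega>)"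

definition isarah_in :: "('s \<Rightarrow> 'a::real_inner \<Rightarrow> real) \<Rightarrow> 'a \<Rightarrow> real \<Rightarrow> nat
    \<Rightarrow> (nat \<Rightarrow> 'o \<Rightarrow> 's) \<Rightarrow> (nat \<Rightarrow> 'o \<Rightarrow> 's) \<Rightarrow> ('o \<Rightarrow> nat) \<Rightarrow> 'o \<Rightarrow> 'a" where
  "isarah_in f w0 \<eta> b \<zeta> \<xi> \<tau> \<omega> =
     isarah_w f w0 \<eta> b (\<lambda>i. \<zeta> i \<omega>) (\<lambda>t. \<xi> t \<omega>) (\<tau> \<omega>)"

end

theory Submission
  imports Defs
begin

text \<open>
  Let \<open>e\<^sub>t = v\<^sub>t - \<nabla>F(w\<^sub>t)\<close>. The descent lemma for \<open>F\<close> bounds \<open>\<Sum>\<parallel>\<nabla>F(w\<^sub>t)\<parallel>\<^sup>2\<close> along every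
  run by \<open>2/\<eta> (F(w\<^sub>0) - F(w\<^sub>*)) + \<Sum>\<parallel>e\<^sub>t\<parallel>\<^sup>2\<close>. Since \<open>e\<^sub>t\<close> is a martingale,
  \<open>E\<parallel>e\<^sub>t\<parallel>\<^sup>2 \<le> E\<parallel>e\<^sub>0\<parallel>\<^sup>2 + \<Sum>E\<parallel>v\<^sub>j - v\<^sub>j\<^sub>-\<^sub>1\<parallel>\<^sup>2\<close>, and cocoercivity of the gradients of the convex
  losses gives \<open>\<parallel>v\<^sub>j - v\<^sub>j\<^sub>-\<^sub>1\<parallel>\<^sup>2 \<le> \<eta>L/(2 - \<eta>L) (\<parallel>v\<^sub>j\<^sub>-\<^sub>1\<parallel>\<^sup>2 - \<parallel>v\<^sub>j\<parallel>\<^sup>2)\<close> along every run, which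
  telescopes to a multiple of \<open>\<parallel>v\<^sub>0\<parallel>\<^sup>2\<close>. The second moments of \<open>v\<^sub>0\<close> and \<open>e\<^sub>0\<close> come from the
  variance of the mini-batch mean and
  \<open>E\<parallel>\<nabla>f(w\<^sub>0)\<parallel>\<^sup>2 \<le> 4L (F(w\<^sub>0) - F(w\<^sub>*)) + 2E\<parallel>\<nabla>f(w\<^sub>*)\<parallel>\<^sup>2\<close>.
\<close>

section \<open>Smooth and convex functions\<close>

text \<open>The parallelogram identity with the squared norm of \<open>x - y\<close>
  discarded.\<close>

lemma norm_add_sq_le: "(norm (x + y))\<^sup>2 \<le> 2 * (norm x)\<^sup>2 + 2 * (norm (y::'a::real_inner))\<^sup>2"
proof -
  have "(norm (x + y))\<^sup>2 + (norm (x - y))\<^sup>2 = 2 * (norm x)\<^sup>2 + 2 * (norm y)\<^sup>2"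
    by (simp add: power2_norm_eq_inner inner_simps inner_commute)
  then show ?thesis
    by (metis le_add_same_cancel1 zero_le_power2)
qed

text \<open>Riesz representation in coordinates: the derivative is the inner product with the vector
  of its values on \<open>Basis\<close>. This is where the definite description in
  \<open>gradient\<close> is known to denote.\<close>

lemma GDERIV_gradient:
  fixes g :: "'a::euclidean_space \<Rightarrow> real"
  assumes "g differentiable (at w)"
  shows "GDERIV g w :> gradient g w"
proof -
  obtain g' where g': "(g has_derivative g') (at w)"
    using assms by (auto simp: differentiable_def)
  then interpret linear g'
    by (rule has_derivative_linear)
  have "g' h = inner h (\<Sum>i\<in>Basis. g' i *\<^sub>R i)" for h
  proof -
    have "g' h = g' (\<Sum>i\<in>Basis. inner h i *\<^sub>R i)"
      by (simp add: euclidean_representation)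
    also have "\<dots> = (\<Sum>i\<in>Basis. inner h i * g' i)"
      by (simp add: sum scale)
    also have "\<dots> = inner h (\<Sum>i\<in>Basis. g' i *\<^sub>R i)"
      by (simp add: inner_sum_right mult.commute)
    finally show ?thesis .
  qed
  then have "g' = (\<lambda>h. inner h (\<Sum>i\<in>Basis. g' i *\<^sub>R i))"
    by (rule ext)
  then have "GDERIV g w :> (\<Sum>i\<in>Basis. g' i *\<^sub>R i)"
    using g' by (simp add: gderiv_def)
  then show ?thesis
    using gradient_eqI by metis
qed

lemma DERIV_along_line:
  fixes g :: "'a::euclidean_space \<Rightarrow> real"
  assumes "\<And>w. g differentiable (at w)"
  shows "((\<lambda>t. g (x + t *\<^sub>R h)) has_real_derivative inner h (gradient g (x + t *\<^sub>R h))) (at t)"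
proof -
  have "((\<lambda>t. x + t *\<^sub>R h) has_derivative (\<lambda>s. s *\<^sub>R h)) (at t)"
    by (auto intro!: derivative_eq_intros)
  moreover have "(g has_derivative (\<lambda>k. inner k (gradient g (x + t *\<^sub>R h)))) (at (x + t *\<^sub>R h))"
    using GDERIV_gradient[OF assms] by (simp add: gderiv_def)
  ultimately have "((\<lambda>t. g (x + t *\<^sub>R h)) has_derivative
      (\<lambda>s. inner (s *\<^sub>R h) (gradient g (x + t *\<^sub>R h)))) (at t)"
    by (rule has_derivative_compose)
  moreover have "(\<lambda>s. inner (s *\<^sub>R h) (gradient g (x + t *\<^sub>R h))) = (*) (inner h (gradient g (x + t *\<^sub>R h)))"
    by (rule ext) (simp add: mult.commute)
  ultimately show ?thesis
    by (simp add: has_field_derivative_def)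
qed

lemma smooth_upper_bound:
  fixes g :: "'a::euclidean_space \<Rightarrow> real"
  assumes diff: "\<And>w. g differentiable (at w)" and "smooth L g"
  shows "g y \<le> g x + inner (y - x) (gradient g x) + L / 2 * (norm (y - x))\<^sup>2"
proof -
  define h where "h = y - x"
  \<comment> \<open>\<phi> is \<open>g\<close> along the segment minus the growth that the quadratic
    bound allows, so the claim is \<phi>(1) \<le> \<phi>(0). Its derivative is nonpositive on [0,1]
    by Cauchy-Schwarz and the Lipschitz bound.\<close>
  define \<phi> where "\<phi> t = g (x + t *\<^sub>R h) - t * inner h (gradient g x) - L / 2 * t\<^sup>2 * (norm h)\<^sup>2" for t
  have "\<phi> 1 \<le> \<phi> 0"
  proof (rule DERIV_nonpos_imp_nonincreasing[of 0 1 \<phi>])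
    fix t :: real assume t: "0 \<le> t" "t \<le> 1"
    have "(\<phi> has_real_derivative inner h (gradient g (x + t *\<^sub>R h)) - inner h (gradient g x)
        - L * t * (norm h)\<^sup>2) (at t)"
      unfolding \<phi>_def by (auto intro!: derivative_eq_intros DERIV_along_line diff)
    moreover have "inner h (gradient g (x + t *\<^sub>R h)) - inner h (gradient g x) \<le> L * t * (norm h)\<^sup>2"
    proof -
      have "inner h (gradient g (x + t *\<^sub>R h)) - inner h (gradient g x)
          \<le> norm h * norm (gradient g (x + t *\<^sub>R h) - gradient g x)"
        by (metis inner_diff_right norm_cauchy_schwarz)
      also have "\<dots> \<le> norm h * (L * norm (x + t *\<^sub>R h - x))"
        using \<open>smooth L g\<close> unfolding smooth_def by (intro mult_left_mono norm_ge_zero) blast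
      also have "\<dots> = L * t * (norm h)\<^sup>2"
        using t by (simp add: power2_eq_square)
      finally show ?thesis .
    qed
    ultimately show "\<exists>d. (\<phi> has_real_derivative d) (at t) \<and> d \<le> 0"
      by force
  qed simp
  then show ?thesis
    by (simp add: \<phi>_def h_def)
qed

text \<open>Restriction to the line through \<open>x\<close> and \<open>y\<close> reduces this to
  the tangent inequality for convex functions of one real variable.\<close>

lemma convex_above_tangent:
  fixes g :: "'a::euclidean_space \<Rightarrow> real"
  assumes diff: "\<And>w. g differentiable (at w)" and cvx: "convex_on UNIV g"
  shows "g y \<ge> g x + inner (y - x) (gradient g x)"
proof -
  define \<phi> where "\<phi> t = g (x + t *\<^sub>R (y - x))" for t
  have "convex_on UNIV \<phi>"
  proof (rule convex_onI)
    fix t a b :: real assume "0 < t" "t < 1"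
    then have "g ((1 - t) *\<^sub>R (x + a *\<^sub>R (y - x)) + t *\<^sub>R (x + b *\<^sub>R (y - x)))
        \<le> (1 - t) * \<phi> a + t * \<phi> b"
      unfolding \<phi>_def by (intro convex_onD[OF cvx]) auto
    then show "\<phi> ((1 - t) *\<^sub>R a + t *\<^sub>R b) \<le> (1 - t) * \<phi> a + t * \<phi> b"
      by (simp add: \<phi>_def algebra_simps)
  qed auto
  moreover have "(\<phi> has_real_derivative inner (y - x) (gradient g x)) (at 0)"
    using DERIV_along_line[OF diff, of x "y - x" 0] unfolding \<phi>_def by simp
  ultimately have "inner (y - x) (gradient g x) * (1 - 0) \<le> \<phi> 1 - \<phi> 0"
    by (intro convex_on_imp_above_tangent[of UNIV]) auto
  then show ?thesis
    by (simp add: \<phi>_def)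
qed

text \<open>The tangent at \<open>x\<close> bounds \<open>g z\<close> from below and the quadratic
  at \<open>y\<close> bounds it from above. The resulting inequality serves twice: symmetrized it is
  cocoercivity, and at a minimizer of \<open>F\<close> it controls the second moment of the sampled
  gradients.\<close>

lemma convex_smooth_lower_bound:
  fixes g :: "'a::euclidean_space \<Rightarrow> real"
  assumes diff: "\<And>w. g differentiable (at w)" and cvx: "convex_on UNIV g" and "smooth L g" and "L > 0"
  shows "g y \<ge> g x + inner (y - x) (gradient g x) + (norm (gradient g y - gradient g x))\<^sup>2 / (2 * L)"
proof -
  define u where "u = gradient g y - gradient g x"
  \<comment> \<open>\<open>z\<close> minimizes the quadratic upper bound at \<open>y\<close> of \<open>g\<close> minus its tangent at \<open>x\<close>.\<close>
  define z where "z = y - (1 / L) *\<^sub>R u"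
  have "g x + inner (z - x) (gradient g x) \<le> g z"
    by (rule convex_above_tangent[OF diff cvx])
  also have "g z \<le> g y + inner (z - y) (gradient g y) + L / 2 * (norm (z - y))\<^sup>2"
    by (rule smooth_upper_bound[OF diff \<open>smooth L g\<close>])
  finally have "g x + inner (y - x) (gradient g x) + inner u u / L - L / 2 * (norm (z - y))\<^sup>2 \<le> g y"
    by (simp add: z_def u_def inner_simps algebra_simps diff_divide_distrib add_divide_distrib)
  moreover have "L / 2 * (norm (z - y))\<^sup>2 = (norm u)\<^sup>2 / (2 * L)"
    using \<open>L > 0\<close> by (simp add: z_def power_divide power2_eq_square)
  moreover have "inner u u / L = (norm u)\<^sup>2 / (2 * L) + (norm u)\<^sup>2 / (2 * L)"
    using \<open>L > 0\<close> by (simp add: power2_norm_eq_inner field_simps)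
  ultimately show ?thesis
    unfolding u_def by linarith
qed

text \<open>The function values cancel when the previous bound is added to itself with
  \<open>x\<close> and \<open>y\<close> exchanged.\<close>

lemma gradient_cocoercive:
  fixes g :: "'a::euclidean_space \<Rightarrow> real"
  assumes "\<And>w. g differentiable (at w)" "convex_on UNIV g" "smooth L g" "L > 0"
  shows "(norm (gradient g y - gradient g x))\<^sup>2 / L \<le> inner (y - x) (gradient g y - gradient g x)"
  using convex_smooth_lower_bound[OF assms, of x y] convex_smooth_lower_bound[OF assms, of y x]
  by (simp add: norm_minus_commute inner_diff_left inner_diff_right inner_commute field_simps)

text \<open>A gradient step of length \<open>1 / L\<close> lowers \<open>g\<close> by at least the
  squared gradient norm over \<open>2 * L\<close>, yet cannot pass below \<open>c\<close>. With
  \<open>c = g x\<close> it shows that the gradient vanishes at a minimizer.\<close>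

lemma gradient_norm_le_gap:
  fixes g :: "'a::euclidean_space \<Rightarrow> real"
  assumes diff: "\<And>w. g differentiable (at w)" and "smooth L g" and "L > 0" and "\<And>w. c \<le> g w"
  shows "(norm (gradient g x))\<^sup>2 \<le> 2 * L * (g x - c)"
proof -
  have "c \<le> g (x - (1 / L) *\<^sub>R gradient g x)" by fact
  also have "\<dots> \<le> g x - (norm (gradient g x))\<^sup>2 / L + L / 2 * (norm (gradient g x) / L)\<^sup>2"
    using smooth_upper_bound[OF diff \<open>smooth L g\<close>, of "x - (1 / L) *\<^sub>R gradient g x" x] \<open>L > 0\<close>
    by (simp add: power2_norm_eq_inner)
  also have "\<dots> = g x - (norm (gradient g x))\<^sup>2 / (2 * L)"
    using \<open>L > 0\<close> by (simp add: field_simps power2_eq_square)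
  finally show ?thesis
    using \<open>L > 0\<close> by (simp add: field_simps)
qed

lemma smooth_continuous_on:
  assumes "smooth L g"
  shows "continuous_on UNIV (gradient g)"
proof -
  \<comment> \<open>\<open>lipschitz_on\<close> demands a nonnegative constant, and the sign of
    \<open>L\<close> is not known here.\<close>
  have "(max L 0)-lipschitz_on UNIV (gradient g)"
  proof (rule lipschitz_onI)
    fix x y
    have "norm (gradient g x - gradient g y) \<le> L * norm (x - y)"
      using assms by (simp add: smooth_def)
    also have "\<dots> \<le> max L 0 * norm (x - y)"
      by (intro mult_right_mono) auto
    finally show "dist (gradient g x) (gradient g y) \<le> max L 0 * dist x y"
      by (simp add: dist_norm)
  qed simp
  then show ?thesis
    by (rule lipschitz_on_continuous_on)
qed

section \<open>Bounds along a single run\<close>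

text \<open>The displacement of the iterate is \<open>- \<eta>\<close> times \<open>v\<close>.
  Cocoercivity of the freshly sampled loss along it forces the norm of \<open>v\<close> to decrease,
  by an amount that pays for the squared increment; the decreases telescope.\<close>

lemma sum_sq_isarah_v_diff_le:
  fixes f :: "'s \<Rightarrow> 'a::euclidean_space \<Rightarrow> real"
  assumes good: "\<And>t. t \<ge> 1 \<Longrightarrow> (\<forall>w. f (x t) differentiable (at w)) \<and> convex_on UNIV (f (x t)) \<and> smooth L (f (x t))"
    and "L > 0" "\<eta> > 0" "\<eta> * L < 2"
  shows "(\<Sum>j<t. (norm (isarah_v f w0 \<eta> b z x (Suc j) - isarah_v f w0 \<eta> b z x j))\<^sup>2)
    \<le> \<eta> * L / (2 - \<eta> * L) * (norm (isarah_v f w0 \<eta> b z x 0))\<^sup>2"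
proof -
  let ?v = "isarah_v f w0 \<eta> b z x" and ?w = "isarah_w f w0 \<eta> b z x"
  define c where "c = \<eta> * L / (2 - \<eta> * L)"
  have c: "c > 0" using assms by (simp add: c_def)
  have step: "(norm (?v (Suc j) - ?v j))\<^sup>2 \<le> c * ((norm (?v j))\<^sup>2 - (norm (?v (Suc j)))\<^sup>2)" for j
  proof -
    define d where "d = ?v (Suc j) - ?v j"
    have d: "d = gradient (f (x (Suc j))) (?w (Suc j)) - gradient (f (x (Suc j))) (?w j)"
      by (simp add: d_def del: isarah_w.simps)
    have "(norm d)\<^sup>2 / L \<le> inner (?w (Suc j) - ?w j) d"
      unfolding d using good[of "Suc j"] \<open>L > 0\<close> by (intro gradient_cocoercive) auto
    also have "\<dots> = - \<eta> * inner (?v j) d"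
      by simp
    finally have 1: "(norm d)\<^sup>2 \<le> - (\<eta> * L) * inner (?v j) d"
      using \<open>L > 0\<close> by (simp add: field_simps)
    \<comment> \<open>Expanding the square trades the inner product for a difference of consecutive
      squared norms, which is what telescopes.\<close>
    have "(norm (?v (Suc j)))\<^sup>2 = (norm (?v j))\<^sup>2 + 2 * inner (?v j) d + (norm d)\<^sup>2"
      by (simp only: power2_norm_eq_inner d_def) (simp add: inner_simps inner_commute del: isarah_v.simps)
    then have "\<eta> * L * ((norm (?v j))\<^sup>2 - (norm (?v (Suc j)))\<^sup>2)
        = - 2 * (\<eta> * L * inner (?v j) d) - \<eta> * L * (norm d)\<^sup>2"
      by (simp add: algebra_simps del: isarah_v.simps)
    with 1 have "(2 - \<eta> * L) * (norm d)\<^sup>2 \<le> \<eta> * L * ((norm (?v j))\<^sup>2 - (norm (?v (Suc j)))\<^sup>2)"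
      by (simp add: algebra_simps del: isarah_v.simps)
    then show ?thesis
      using assms unfolding c_def d_def[symmetric] by (simp add: field_simps del: isarah_v.simps)
  qed
  have "(\<Sum>j<t. (norm (?v (Suc j) - ?v j))\<^sup>2) \<le> (\<Sum>j<t. c * ((norm (?v j))\<^sup>2 - (norm (?v (Suc j)))\<^sup>2))"
    by (intro sum_mono step)
  also have "\<dots> = c * ((norm (?v 0))\<^sup>2 - (norm (?v t))\<^sup>2)"
    unfolding sum_distrib_left[symmetric] sum_lessThan_telescope'[of "\<lambda>j. (norm (?v j))\<^sup>2"] by (rule refl)
  also have "\<dots> \<le> c * (norm (?v 0))\<^sup>2"
    using c by (intro mult_left_mono) auto
  finally show ?thesis by (simp only: c_def)
qed

text \<open>In the descent inequality, \<open>\<eta> * L \<le> 1\<close> enlarges the quadratic term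
  to \<eta>/2 times the squared norm of \<open>v\<close>. Completing the square with the inner
  product of \<open>v\<close> and the gradient then leaves exactly the squared error minus the
  squared gradient, and the values of \<open>F\<close> telescope.\<close>

lemma sum_sq_gradient_le:
  fixes F :: "'a::euclidean_space \<Rightarrow> real"
  assumes diff: "\<And>w. F differentiable (at w)" and "smooth L F" and lower: "\<And>w. c \<le> F w"
    and "\<eta> > 0" "\<eta> * L \<le> 1"
  shows "(\<Sum>t\<le>m. (norm (gradient F (isarah_w f w0 \<eta> b z x t)))\<^sup>2)
    \<le> 2 / \<eta> * (F w0 - c)
      + (\<Sum>t\<le>m. (norm (isarah_v f w0 \<eta> b z x t - gradient F (isarah_w f w0 \<eta> b z x t)))\<^sup>2)"
proof -
  let ?v = "isarah_v f w0 \<eta> b z x" and ?w = "isarah_w f w0 \<eta> b z x"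
  have step: "(norm (gradient F (?w t)))\<^sup>2
      \<le> 2 / \<eta> * (F (?w t) - F (?w (Suc t))) + (norm (?v t - gradient F (?w t)))\<^sup>2" for t
  proof -
    define G where "G = gradient F (?w t)"
    have "F (?w (Suc t)) \<le> F (?w t) - \<eta> * inner (?v t) G + L / 2 * (norm (\<eta> *\<^sub>R ?v t))\<^sup>2"
      using smooth_upper_bound[OF diff \<open>smooth L F\<close>, of "?w (Suc t)" "?w t"] by (simp add: G_def)
    also have "L / 2 * (norm (\<eta> *\<^sub>R ?v t))\<^sup>2 = \<eta> / 2 * ((\<eta> * L) * (norm (?v t))\<^sup>2)"
      using \<open>\<eta> > 0\<close> by (simp add: power_mult_distrib power2_eq_square)
    also have "\<dots> \<le> \<eta> / 2 * (1 * (norm (?v t))\<^sup>2)"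
      using assms by (intro mult_left_mono mult_right_mono) auto
    finally have "F (?w (Suc t)) \<le> F (?w t) - \<eta> * inner (?v t) G + \<eta> / 2 * (norm (?v t))\<^sup>2"
      by simp
    moreover have "\<eta> / 2 * (norm (?v t - G))\<^sup>2
        = \<eta> / 2 * ((norm (?v t))\<^sup>2 - 2 * inner (?v t) G + (norm G)\<^sup>2)"
      by (simp add: power2_norm_eq_inner inner_simps inner_commute)
    ultimately have "\<eta> / 2 * (norm G)\<^sup>2 \<le> F (?w t) - F (?w (Suc t)) + \<eta> / 2 * (norm (?v t - G))\<^sup>2"
      by (simp add: algebra_simps del: isarah_w.simps)
    then show ?thesis
      using \<open>\<eta> > 0\<close> unfolding G_def[symmetric] by (simp add: field_simps del: isarah_w.simps)
  qed
  have "(\<Sum>t\<le>m. (norm (gradient F (?w t)))\<^sup>2)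
      \<le> (\<Sum>t\<le>m. 2 / \<eta> * (F (?w t) - F (?w (Suc t))) + (norm (?v t - gradient F (?w t)))\<^sup>2)"
    by (intro sum_mono step)
  also have "\<dots> = 2 / \<eta> * (F w0 - F (?w (Suc m))) + (\<Sum>t\<le>m. (norm (?v t - gradient F (?w t)))\<^sup>2)"
    unfolding sum.distrib sum_distrib_left[symmetric] sum_telescope[of "\<lambda>t. F (?w t)"] by simp
  also have "\<dots> \<le> 2 / \<eta> * (F w0 - c) + (\<Sum>t\<le>m. (norm (?v t - gradient F (?w t)))\<^sup>2)"
    using lower[of "?w (Suc m)"] \<open>\<eta> > 0\<close> by (intro add_right_mono mult_left_mono) auto
  finally show ?thesis .
qed

text \<open>Adaptedness, with a lag: the sample \<open>x t\<close> enters \<open>v\<close> at time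
  \<open>t\<close>, but the iterate only at time \<open>Suc t\<close>. Hence a fresh sample is
  independent of both points at which its gradient is evaluated.\<close>

lemma isarah_cong:
  assumes "\<And>i. i \<in> {1..b} \<Longrightarrow> z i = z' i"
  shows "(\<And>i. i \<in> {1..<t} \<Longrightarrow> x i = x' i) \<Longrightarrow> isarah_w f w0 \<eta> b z x t = isarah_w f w0 \<eta> b z' x' t"
    and "(\<And>i. i \<in> {1..t} \<Longrightarrow> x i = x' i) \<Longrightarrow> isarah_v f w0 \<eta> b z x t = isarah_v f w0 \<eta> b z' x' t"
proof (induction t)
  case 0
  { case 1 show ?case by simp
  next
    case 2 show ?case using assms by simp }
next
  case (Suc t)
  { case 1 then show ?case using Suc.IH by simp
  next
    case 2
    then have "x (Suc t) = x' (Suc t)" "isarah_v f w0 \<eta> b z x t = isarah_v f w0 \<eta> b z' x' t"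
      "isarah_w f w0 \<eta> b z x t = isarah_w f w0 \<eta> b z' x' t"
      using Suc.IH by auto
    then show ?case by simp }
qed

section \<open>Measurability and independence\<close>

text \<open>Rounding \<open>w\<close> to a nearby point of a countable dense sequence leaves
  countably many measurable cases, and continuity in \<open>w\<close> recovers \<open>g\<close> in
  the limit. It makes sampled gradients at random points measurable.\<close>

lemma borel_measurable_caratheodory:
  fixes g :: "'s \<Rightarrow> 'a::{second_countable_topology, metric_space} \<Rightarrow> 'b::metric_space"
  assumes meas: "\<And>w. (\<lambda>s. g s w) \<in> borel_measurable D"
    and cont: "\<And>s. s \<in> space D \<Longrightarrow> continuous_on UNIV (g s)"
  shows "(\<lambda>(s, w). g s w) \<in> borel_measurable (D \<Otimes>\<^sub>M borel)"
proof -
  obtain Q :: "'a set" where Q: "countable Q" "\<And>X. open X \<Longrightarrow> X \<noteq> {} \<Longrightarrow> \<exists>d\<in>Q. d \<in> X"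
    by (rule countable_dense_setE) blast
  define q where "q = from_nat_into Q"
  have dense: "\<exists>k. dist (q k) w < e" if "e > 0" for e w
  proof -
    have "ball w e \<noteq> {}"
      using that by simp
    then obtain d where "d \<in> Q" "d \<in> ball w e"
      using Q(2)[OF open_ball] by blast
    moreover have "q (to_nat_on Q d) = d"
      using Q(1) \<open>d \<in> Q\<close> by (simp add: q_def)
    ultimately show ?thesis
      by (metis dist_commute mem_ball)
  qed
  \<comment> \<open>Taking the least admissible index makes the choice measurable in
    \<open>w\<close>, as it is decided by countably many comparisons of distances.\<close>
  define K where "K n w = (LEAST k. dist (q k) w < 1 / real (Suc n))" for n w
  have K: "dist (q (K n w)) w < 1 / real (Suc n)" for n w
    unfolding K_def by (rule LeastI_ex) (rule dense, simp)
  show ?thesis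
  proof (rule borel_measurable_LIMSEQ_metric)
    fix n
    have "(\<lambda>p. g (fst p) (q (K n (snd p)))) \<in> borel_measurable (D \<Otimes>\<^sub>M borel)"
    proof (rule measurable_compose_countable[where f = "\<lambda>k p. g (fst p) (q k)"])
      show "(\<lambda>p. g (fst p) (q k)) \<in> borel_measurable (D \<Otimes>\<^sub>M borel)" for k
        using measurable_compose[OF measurable_fst meas] .
      show "(\<lambda>p. K n (snd p)) \<in> D \<Otimes>\<^sub>M borel \<rightarrow>\<^sub>M count_space UNIV"
        unfolding K_def by measurable
    qed
    then show "(\<lambda>(s, w). g s (q (K n w))) \<in> borel_measurable (D \<Otimes>\<^sub>M borel)"
      by (simp add: split_beta')
  next
    fix p :: "'s \<times> 'a" assume "p \<in> space (D \<Otimes>\<^sub>M borel)"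
    then obtain s w where p: "p = (s, w)" "s \<in> space D"
      by (auto simp: space_pair_measure)
    have "(\<lambda>n. dist (q (K n w)) w) \<longlonglongrightarrow> 0"
    proof (rule tendsto_sandwich[OF _ _ tendsto_const])
      show "(\<lambda>n. 1 / real (Suc n)) \<longlonglongrightarrow> 0"
        by (rule LIMSEQ_Suc[OF lim_1_over_n])
      show "\<forall>\<^sub>F n in sequentially. dist (q (K n w)) w \<le> 1 / real (Suc n)"
        using K by (intro always_eventually) (auto intro: less_imp_le)
    qed auto
    then have "(\<lambda>n. q (K n w)) \<longlonglongrightarrow> w"
      by (simp add: tendsto_dist_iff[symmetric])
    then have "(\<lambda>n. g s (q (K n w))) \<longlonglongrightarrow> g s w"
      using continuous_on_tendsto_compose[OF cont[OF p(2)]] by auto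
    then show "(\<lambda>n. case p of (s, w) \<Rightarrow> g s (q (K n w))) \<longlonglongrightarrow> (case p of (s, w) \<Rightarrow> g s w)"
      by (simp add: p)
  qed
qed

lemma Int_stable_vimage: "Int_stable {X -` A \<inter> \<Omega> |A. A \<in> sets S}"
proof (rule Int_stableI)
  fix a b assume "a \<in> {X -` A \<inter> \<Omega> |A. A \<in> sets S}" "b \<in> {X -` A \<inter> \<Omega> |A. A \<in> sets S}"
  then obtain A B where "A \<in> sets S" "B \<in> sets S" "a = X -` A \<inter> \<Omega>" "b = X -` B \<inter> \<Omega>"
    by blast
  then show "a \<inter> b \<in> {X -` A \<inter> \<Omega> |A. A \<in> sets S}"
    by (intro CollectI exI[of _ "A \<inter> B"]) auto
qed

section \<open>Independent samples: orthogonality of centered increments and a random index\<close>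

context prob_space
begin

text \<open>The centered variable is orthogonal in mean to the constant \<open>e\<close>, so the
  cross term vanishes. The squared norm of the mean stands as a summand on the left because
  subtraction in \<open>ennreal\<close> is truncated.\<close>

lemma nn_integral_sq_norm_centered:
  fixes X :: "'a \<Rightarrow> 'b::euclidean_space"
  assumes X: "integrable M X" and X2: "integrable M (\<lambda>\<omega>. (norm (X \<omega>))\<^sup>2)"
  shows "(\<integral>\<^sup>+\<omega>. ennreal ((norm (e + (X \<omega> - expectation X)))\<^sup>2) \<partial>M) + ennreal ((norm (expectation X))\<^sup>2)
    = ennreal ((norm e)\<^sup>2) + (\<integral>\<^sup>+\<omega>. ennreal ((norm (X \<omega>))\<^sup>2) \<partial>M)"
proof -
  define \<mu> where "\<mu> = expectation X"
  have eq: "(norm (e + (X \<omega> - \<mu>)))\<^sup>2 = (norm (X \<omega>))\<^sup>2 + 2 * inner (X \<omega>) (e - \<mu>) + (norm (e - \<mu>))\<^sup>2" for \<omega>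
    by (simp add: power2_norm_eq_inner inner_simps inner_commute)
  have int: "integrable M (\<lambda>\<omega>. (norm (e + (X \<omega> - \<mu>)))\<^sup>2)"
    unfolding eq using X X2 by simp
  have "expectation (\<lambda>\<omega>. (norm (e + (X \<omega> - \<mu>)))\<^sup>2)
      = expectation (\<lambda>\<omega>. (norm (X \<omega>))\<^sup>2) + 2 * inner \<mu> (e - \<mu>) + (norm (e - \<mu>))\<^sup>2"
    unfolding eq using X X2 by (simp add: \<mu>_def prob_space)
  then have "expectation (\<lambda>\<omega>. (norm (e + (X \<omega> - \<mu>)))\<^sup>2) + (norm \<mu>)\<^sup>2
      = (norm e)\<^sup>2 + expectation (\<lambda>\<omega>. (norm (X \<omega>))\<^sup>2)"
    by (simp add: power2_norm_eq_inner inner_simps inner_commute)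
  then show ?thesis
    using int X2 unfolding \<mu>_def[symmetric]
    by (simp add: nn_integral_eq_integral ennreal_plus[symmetric] integral_nonneg_AE del: ennreal_plus)
qed

text \<open>The block \<open>A\<close> and the coordinate \<open>k\<close> are disjoint, hence
  independent. Their joint law is a product, and the sample \<open>X k\<close> can be integrated out
  against \<open>D\<close> with the past frozen.\<close>

lemma nn_integral_indep_fubini:
  assumes D: "prob_space D" and ind: "indep_vars (\<lambda>_. D) X J" and AJ: "A \<subseteq> J" "k \<in> J" "k \<notin> A"
    and law: "distr M D (X k) = D"
    and h[measurable]: "h \<in> borel_measurable ((\<Pi>\<^sub>M j\<in>A. D) \<Otimes>\<^sub>M D)"
  shows "(\<integral>\<^sup>+\<omega>. h (\<lambda>j\<in>A. X j \<omega>, X k \<omega>) \<partial>M) = (\<integral>\<^sup>+\<omega>. \<integral>\<^sup>+s. h (\<lambda>j\<in>A. X j \<omega>, s) \<partial>D \<partial>M)"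
proof -
  interpret D: prob_space D by fact
  \<comment> \<open>\<open>indep_var\<close> wants both variables in one type, so the single sample
    is packaged as a function on \<open>{k}\<close>; \<open>lawQ\<close> unpacks it again.\<close>
  let ?S = "\<Pi>\<^sub>M j\<in>A. D" and ?T = "\<Pi>\<^sub>M j\<in>{k}. D"
  let ?P = "\<lambda>\<omega>. \<lambda>j\<in>A. X j \<omega>" and ?Q = "\<lambda>\<omega>. \<lambda>j\<in>{k}. X j \<omega>"
  have "indep_var ?S ?P ?T ?Q"
    using indep_var_restrict[OF ind, of A "{k}"] AJ by auto
  then have P[measurable]: "?P \<in> M \<rightarrow>\<^sub>M ?S" and Q[measurable]: "?Q \<in> M \<rightarrow>\<^sub>M ?T"
    and joint: "distr M ?S ?P \<Otimes>\<^sub>M distr M ?T ?Q = distr M (?S \<Otimes>\<^sub>M ?T) (\<lambda>\<omega>. (?P \<omega>, ?Q \<omega>))"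
    by (auto simp: indep_var_distribution_eq)
  have [measurable]: "(\<lambda>q. q k) \<in> ?T \<rightarrow>\<^sub>M D"
    by (rule measurable_component_singleton) simp
  interpret Q: prob_space "distr M ?T ?Q" by (rule prob_space_distr) fact
  have lawQ: "distr (distr M ?T ?Q) D (\<lambda>q. q k) = D"
    by (subst distr_distr) (simp_all add: comp_def law)
  have "(\<integral>\<^sup>+\<omega>. h (?P \<omega>, X k \<omega>) \<partial>M) = (\<integral>\<^sup>+\<omega>. h (fst (?P \<omega>, ?Q \<omega>), snd (?P \<omega>, ?Q \<omega>) k) \<partial>M)"
    by simp
  also have "\<dots> = (\<integral>\<^sup>+r. h (fst r, snd r k) \<partial>distr M (?S \<Otimes>\<^sub>M ?T) (\<lambda>\<omega>. (?P \<omega>, ?Q \<omega>)))"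
    by (subst nn_integral_distr) measurable
  also have "\<dots> = (\<integral>\<^sup>+p. \<integral>\<^sup>+q. h (p, q k) \<partial>distr M ?T ?Q \<partial>distr M ?S ?P)"
    unfolding joint[symmetric]
    by (subst Q.nn_integral_fst[symmetric]) (simp_all cong: measurable_cong_sets)
  also have "\<dots> = (\<integral>\<^sup>+p. \<integral>\<^sup>+s. h (p, s) \<partial>D \<partial>distr M ?S ?P)"
  proof (rule nn_integral_cong)
    fix p assume "p \<in> space (distr M ?S ?P)"
    then have "p \<in> space ?S" by simp
    then have "(\<lambda>s. h (p, s)) \<in> borel_measurable D"
      by measurable
    then show "(\<integral>\<^sup>+q. h (p, q k) \<partial>distr M ?T ?Q) = (\<integral>\<^sup>+s. h (p, s) \<partial>D)"
      by (subst (2) lawQ[symmetric], subst nn_integral_distr) (simp_all cong: measurable_cong_sets)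
  qed
  also have "\<dots> = (\<integral>\<^sup>+\<omega>. \<integral>\<^sup>+s. h (?P \<omega>, s) \<partial>D \<partial>M)"
    by (subst nn_integral_distr[OF P]) simp_all
  finally show ?thesis .
qed

text \<open>Pythagoras conditionally on the past \<open>P\<close>: \<delta> is the conditional mean
  of the increment \<open>d\<close>, so the centered increment is orthogonal to \<open>e\<close>. It
  serves the iteration as well as the mini-batch, one sample at a time.\<close>

lemma nn_integral_sq_norm_martingale_step:
  fixes e :: "('i \<Rightarrow> 's) \<Rightarrow> 'b::euclidean_space"
  assumes D: "prob_space D" and ind: "indep_vars (\<lambda>_. D) X J" and AJ: "A \<subseteq> J" "k \<in> J" "k \<notin> A"
    and law: "distr M D (X k) = D"
    and e[measurable]: "e \<in> borel_measurable (\<Pi>\<^sub>M j\<in>A. D)"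
    and d[measurable]: "(\<lambda>(p, s). d p s) \<in> borel_measurable ((\<Pi>\<^sub>M j\<in>A. D) \<Otimes>\<^sub>M D)"
    and int: "\<And>p. p \<in> space (\<Pi>\<^sub>M j\<in>A. D) \<Longrightarrow> integrable D (d p)"
    and int2: "\<And>p. p \<in> space (\<Pi>\<^sub>M j\<in>A. D) \<Longrightarrow> integrable D (\<lambda>s. (norm (d p s))\<^sup>2)"
    and \<delta>: "\<And>p. p \<in> space (\<Pi>\<^sub>M j\<in>A. D) \<Longrightarrow> \<delta> p = (\<integral>s. d p s \<partial>D)"
  defines "P \<equiv> \<lambda>\<omega>. \<lambda>j\<in>A. X j \<omega>"
  shows "(\<integral>\<^sup>+\<omega>. ennreal ((norm (e (P \<omega>) + (d (P \<omega>) (X k \<omega>) - \<delta> (P \<omega>))))\<^sup>2) \<partial>M)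
      + (\<integral>\<^sup>+\<omega>. ennreal ((norm (\<delta> (P \<omega>)))\<^sup>2) \<partial>M)
    = (\<integral>\<^sup>+\<omega>. ennreal ((norm (e (P \<omega>)))\<^sup>2) \<partial>M) + (\<integral>\<^sup>+\<omega>. ennreal ((norm (d (P \<omega>) (X k \<omega>)))\<^sup>2) \<partial>M)"
proof -
  interpret D: prob_space D by fact
  have rv: "X j \<in> M \<rightarrow>\<^sub>M D" if "j \<in> J" for j
    using ind that by (auto simp: indep_vars_def)
  have P[measurable]: "P \<in> M \<rightarrow>\<^sub>M (\<Pi>\<^sub>M j\<in>A. D)"
    unfolding P_def using AJ by (intro measurable_restrict rv) auto
  have [measurable]: "(\<lambda>p. \<integral>s. d p s \<partial>D) \<in> borel_measurable (\<Pi>\<^sub>M j\<in>A. D)"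
    using d by measurable
  have \<delta>_meas[measurable]: "\<delta> \<in> borel_measurable (\<Pi>\<^sub>M j\<in>A. D)"
    by (subst measurable_cong[OF \<delta>]) measurable
  have fubini: "(\<integral>\<^sup>+\<omega>. h (P \<omega>, X k \<omega>) \<partial>M) = (\<integral>\<^sup>+\<omega>. \<integral>\<^sup>+s. h (P \<omega>, s) \<partial>D \<partial>M)"
    if "h \<in> borel_measurable ((\<Pi>\<^sub>M j\<in>A. D) \<Otimes>\<^sub>M D)" for h
    unfolding P_def by (rule nn_integral_indep_fubini[OF D ind AJ law that])
  have "(\<integral>\<^sup>+\<omega>. ennreal ((norm (e (P \<omega>) + (d (P \<omega>) (X k \<omega>) - \<delta> (P \<omega>))))\<^sup>2) \<partial>M)
      = (\<integral>\<^sup>+\<omega>. \<integral>\<^sup>+s. ennreal ((norm (e (P \<omega>) + (d (P \<omega>) s - \<delta> (P \<omega>))))\<^sup>2) \<partial>D \<partial>M)"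
    using fubini[of "\<lambda>(p, s). ennreal ((norm (e p + (d p s - \<delta> p)))\<^sup>2)"] by simp
  moreover have "(\<integral>\<^sup>+\<omega>. ennreal ((norm (d (P \<omega>) (X k \<omega>)))\<^sup>2) \<partial>M)
      = (\<integral>\<^sup>+\<omega>. \<integral>\<^sup>+s. ennreal ((norm (d (P \<omega>) s))\<^sup>2) \<partial>D \<partial>M)"
    using fubini[of "\<lambda>(p, s). ennreal ((norm (d p s))\<^sup>2)"] by simp
  \<comment> \<open>Each side becomes one integral over \<open>M\<close>, so that the centered
    identity can be applied under the integral, separately for every past.\<close>
  moreover have "(\<integral>\<^sup>+\<omega>. \<integral>\<^sup>+s. ennreal ((norm (e (P \<omega>) + (d (P \<omega>) s - \<delta> (P \<omega>))))\<^sup>2) \<partial>D \<partial>M)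
      + (\<integral>\<^sup>+\<omega>. ennreal ((norm (\<delta> (P \<omega>)))\<^sup>2) \<partial>M)
    = (\<integral>\<^sup>+\<omega>. ennreal ((norm (e (P \<omega>)))\<^sup>2) \<partial>M) + (\<integral>\<^sup>+\<omega>. \<integral>\<^sup>+s. ennreal ((norm (d (P \<omega>) s))\<^sup>2) \<partial>D \<partial>M)"
  proof (subst (1 2) nn_integral_add[symmetric])
    show "(\<integral>\<^sup>+\<omega>. (\<integral>\<^sup>+s. ennreal ((norm (e (P \<omega>) + (d (P \<omega>) s - \<delta> (P \<omega>))))\<^sup>2) \<partial>D)
        + ennreal ((norm (\<delta> (P \<omega>)))\<^sup>2) \<partial>M)
      = (\<integral>\<^sup>+\<omega>. ennreal ((norm (e (P \<omega>)))\<^sup>2) + (\<integral>\<^sup>+s. ennreal ((norm (d (P \<omega>) s))\<^sup>2) \<partial>D) \<partial>M)"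
    proof (rule nn_integral_cong)
      fix \<omega> assume "\<omega> \<in> space M"
      then have p: "P \<omega> \<in> space (\<Pi>\<^sub>M j\<in>A. D)"
        using P by (rule measurable_space[rotated])
      show "(\<integral>\<^sup>+s. ennreal ((norm (e (P \<omega>) + (d (P \<omega>) s - \<delta> (P \<omega>))))\<^sup>2) \<partial>D) + ennreal ((norm (\<delta> (P \<omega>)))\<^sup>2)
        = ennreal ((norm (e (P \<omega>)))\<^sup>2) + (\<integral>\<^sup>+s. ennreal ((norm (d (P \<omega>) s))\<^sup>2) \<partial>D)"
        unfolding \<delta>[OF p] by (rule D.nn_integral_sq_norm_centered[OF int[OF p] int2[OF p]])
    qed
  qed measurable
  ultimately show ?thesis
    by simp
qed

text \<open>Almost surely the value at the random index is the sum over \<open>t\<close> of the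
  indicator of \<tau> = t times the value at \<open>t\<close>. Independence factors each
  expectation, and each indicator has mean \<open>1 / (m + 1)\<close>.\<close>

lemma uniform_index_expectation:
  fixes h :: "nat \<Rightarrow> 'c \<Rightarrow> real"
  assumes law: "distr M (count_space UNIV) \<tau> = measure_pmf (pmf_of_set {0..m})"
    and ind: "indep_rvs (count_space UNIV) \<tau> S Y"
    and h[measurable]: "\<And>t. h t \<in> borel_measurable S"
    and int: "\<And>t. t \<le> m \<Longrightarrow> integrable M (\<lambda>\<omega>. h t (Y \<omega>))"
  shows "integrable M (\<lambda>\<omega>. h (\<tau> \<omega>) (Y \<omega>))"
    and "expectation (\<lambda>\<omega>. h (\<tau> \<omega>) (Y \<omega>)) = (\<Sum>t\<le>m. expectation (\<lambda>\<omega>. h t (Y \<omega>))) / real (m + 1)"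
proof -
  have [measurable]: "\<tau> \<in> M \<rightarrow>\<^sub>M count_space UNIV" "Y \<in> M \<rightarrow>\<^sub>M S"
    and prod: "\<And>A B. B \<in> sets S \<Longrightarrow> prob ((\<tau> -` A \<inter> space M) \<inter> (Y -` B \<inter> space M))
      = prob (\<tau> -` A \<inter> space M) * prob (Y -` B \<inter> space M)"
    using ind unfolding indep_rvs_def indep_sets2_eq by auto blast+
  let ?I = "\<lambda>t \<omega>. indicator {t} (\<tau> \<omega>) :: real"
  have I_meas: "?I t \<in> borel_measurable M" for t
    by (rule measurable_compose[of \<tau> M "count_space UNIV"]) simp_all
  \<comment> \<open>Preimages under the two transforms are preimages under \<tau> and
    \<open>Y\<close>, so they satisfy the product rule. Being closed under intersections, these
    families pass independence on to the sigma-algebras they generate.\<close>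
  have indep: "indep_var borel (?I t) borel (\<lambda>\<omega>. h t (Y \<omega>))" for t
    unfolding indep_var_eq
  proof (intro conjI indep_set_sigma_sets)
    show "indep_set {?I t -` A \<inter> space M |A. A \<in> sets borel} {(\<lambda>\<omega>. h t (Y \<omega>)) -` B \<inter> space M |B. B \<in> sets borel}"
      unfolding indep_sets2_eq
    proof (intro conjI ballI)
      fix a b assume "a \<in> {?I t -` A \<inter> space M |A. A \<in> sets borel}"
        "b \<in> {(\<lambda>\<omega>. h t (Y \<omega>)) -` B \<inter> space M |B. B \<in> sets borel}"
      then obtain A B where AB: "B \<in> sets borel" "a = ?I t -` A \<inter> space M" "b = (\<lambda>\<omega>. h t (Y \<omega>)) -` B \<inter> space M"
        by auto
      have "a = \<tau> -` {i. indicator {t} i \<in> A} \<inter> space M"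
        by (auto simp: AB)
      moreover have "b = Y -` (h t -` B \<inter> space S) \<inter> space M"
        using measurable_space[of Y M S] by (auto simp: AB)
      moreover have "h t -` B \<inter> space S \<in> sets S"
        using AB(1) by measurable
      ultimately show "prob (a \<inter> b) = prob a * prob b"
        using prod by metis
    qed (auto intro!: measurable_sets I_meas)
    show "random_variable borel (?I t)" "random_variable borel (\<lambda>\<omega>. h t (Y \<omega>))"
      using I_meas by simp_all
  qed (rule Int_stable_vimage)+
  have prob_eq: "expectation (?I t) = 1 / real (m + 1)" if "t \<le> m" for t
  proof -
    have "expectation (?I t) = (\<integral>i. indicator {t} i \<partial>distr M (count_space UNIV) \<tau>)"
      by (subst integral_distr) auto
    also have "\<dots> = pmf (pmf_of_set {0..m}) t"
      unfolding law by (simp add: pmf.rep_eq)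
    also have "\<dots> = 1 / real (m + 1)"
      using that by (simp add: pmf_of_set)
    finally show ?thesis .
  qed
  have I: "integrable M (?I t)" for t
    by (rule integrable_const_bound[where B = 1]) (use I_meas in auto)
  have prod_int: "integrable M (\<lambda>\<omega>. ?I t \<omega> * h t (Y \<omega>))" if "t \<le> m" for t
    by (rule indep_var_integrable[OF indep I int[OF that]])
  have sum_int: "integrable M (\<lambda>\<omega>. \<Sum>t\<le>m. ?I t \<omega> * h t (Y \<omega>))"
    by (rule Bochner_Integration.integrable_sum) (use prod_int in auto)
  \<comment> \<open>Only the law of \<tau> is prescribed, so the bound by \<open>m\<close> holds
    almost surely rather than everywhere.\<close>
  have "AE i in measure_pmf (pmf_of_set {0..m}). i \<le> m"
    by (simp add: AE_measure_pmf_iff)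
  then have "AE \<omega> in M. \<tau> \<omega> \<le> m"
    unfolding law[symmetric] by (subst (asm) AE_distr_iff) auto
  then have ae: "AE \<omega> in M. (\<Sum>t\<le>m. ?I t \<omega> * h t (Y \<omega>)) = h (\<tau> \<omega>) (Y \<omega>)"
    by eventually_elim (simp add: indicator_def sum.delta if_distrib[of "\<lambda>c. c * _"] cong: if_cong)
  have meas: "(\<lambda>\<omega>. h (\<tau> \<omega>) (Y \<omega>)) \<in> borel_measurable M"
    by (rule measurable_compose_countable[where f = "\<lambda>t \<omega>. h t (Y \<omega>)"]) measurable
  show "integrable M (\<lambda>\<omega>. h (\<tau> \<omega>) (Y \<omega>))"
    using integrable_cong_AE_imp[OF sum_int meas ae] .
  have "expectation (\<lambda>\<omega>. h (\<tau> \<omega>) (Y \<omega>)) = expectation (\<lambda>\<omega>. \<Sum>t\<le>m. ?I t \<omega> * h t (Y \<omega>))"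
    by (intro integral_cong_AE) (use meas ae sum_int in \<open>auto elim: AE_mp\<close>)
  also have "\<dots> = (\<Sum>t\<le>m. expectation (\<lambda>\<omega>. ?I t \<omega> * h t (Y \<omega>)))"
    by (rule Bochner_Integration.integral_sum) (use prod_int in auto)
  also have "\<dots> = (\<Sum>t\<le>m. expectation (?I t) * expectation (\<lambda>\<omega>. h t (Y \<omega>)))"
    by (intro sum.cong refl indep_var_lebesgue_integral[OF indep I int]) auto
  also have "\<dots> = (\<Sum>t\<le>m. 1 / real (m + 1) * expectation (\<lambda>\<omega>. h t (Y \<omega>)))"
    by (intro sum.cong refl arg_cong2[where f = "(*)"] prob_eq) auto
  also have "\<dots> = (\<Sum>t\<le>m. expectation (\<lambda>\<omega>. h t (Y \<omega>))) / real (m + 1)"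
    by (simp add: sum_divide_distrib)
  finally show "expectation (\<lambda>\<omega>. h (\<tau> \<omega>) (Y \<omega>)) = (\<Sum>t\<le>m. expectation (\<lambda>\<omega>. h t (Y \<omega>))) / real (m + 1)" .
qed

end

section \<open>The stochastic recursion\<close>

text \<open>The step size stays general up to \<open>\<eta> * L \<le> 1\<close>, and so does the
  batch size; both are specialized only when the final constants are computed.\<close>

locale isarah = prob_space M + D: prob_space D
  for M :: "'o measure" and D :: "'s measure" +
  fixes f :: "'s \<Rightarrow> 'a::euclidean_space \<Rightarrow> real"
    and F :: "'a \<Rightarrow> real"
    and w0 w_star :: 'a
    and L \<eta> :: real
    and b :: nat
    and \<zeta> \<xi> :: "nat \<Rightarrow> 'o \<Rightarrow> 's"
  assumes f_diff: "\<And>s w. s \<in> space D \<Longrightarrow> f s differentiable (at w)"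
    and f_int: "\<And>w. integrable D (\<lambda>s. f s w)"
    and F_eq: "\<And>w. F w = (\<integral>s. f s w \<partial>D)"
    and F_diff: "\<And>w. F differentiable (at w)"
    and grad_int: "\<And>w. integrable D (\<lambda>s. gradient (f s) w)"
    and grad_F: "\<And>w. (\<integral>s. gradient (f s) w \<partial>D) = gradient F w"
    and L_pos: "L > 0"
    and f_convex: "\<And>s. s \<in> space D \<Longrightarrow> convex_on UNIV (f s)"
    and f_smooth: "\<And>s. s \<in> space D \<Longrightarrow> smooth L (f s)"
    and F_min: "\<And>w. F w_star \<le> F w"
    and grad_sq_int_star: "integrable D (\<lambda>s. (norm (gradient (f s) w_star))\<^sup>2)"
    and indep: "indep_vars (\<lambda>_. D) (case_sum \<zeta> \<xi>) ({1..b} <+> {1..})"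
    and \<zeta>_law: "\<And>i. i \<in> {1..b} \<Longrightarrow> distr M D (\<zeta> i) = D"
    and \<xi>_law: "\<And>t. t \<ge> 1 \<Longrightarrow> distr M D (\<xi> t) = D"
    and \<eta>_pos: "\<eta> > 0"
    and \<eta>_L: "\<eta> * L \<le> 1"
    and b_pos: "b > 0"
begin

text \<open>Mini-batch samples (\<open>Inl\<close>) and step samples (\<open>Inr\<close>) form a
  single independent family, so the past at any stage is a subset of one index set.\<close>

abbreviation "J \<equiv> {1..b} <+> {1::nat..}"

abbreviation "X \<equiv> case_sum \<zeta> \<xi>"

text \<open>Iterates are functions of a sample assignment instead of an outcome, so that
  measurability can be stated on product spaces and the assignment can be cut down to the samples
  already seen.\<close>

definition W :: "nat \<Rightarrow> (nat + nat \<Rightarrow> 's) \<Rightarrow> 'a" where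
  "W t y = isarah_w f w0 \<eta> b (\<lambda>i. y (Inl i)) (\<lambda>i. y (Inr i)) t"

definition V :: "nat \<Rightarrow> (nat + nat \<Rightarrow> 's) \<Rightarrow> 'a" where
  "V t y = isarah_v f w0 \<eta> b (\<lambda>i. y (Inl i)) (\<lambda>i. y (Inr i)) t"

abbreviation "S \<omega> \<equiv> \<lambda>j. X j \<omega>"

definition V_err :: "nat \<Rightarrow> (nat + nat \<Rightarrow> 's) \<Rightarrow> 'a" where
  "V_err t y = V t y - gradient F (W t y)"

text \<open>The trace of the covariance of one sampled gradient at \<open>w0\<close>.\<close>

definition variance0 :: real where
  "variance0 = (\<integral>s. (norm (gradient (f s) w0))\<^sup>2 \<partial>D) - (norm (gradient F w0))\<^sup>2"

section \<open>Samples, sampled gradients and the smoothness of \<open>F\<close>\<close>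

lemma X_rv: "j \<in> J \<Longrightarrow> X j \<in> M \<rightarrow>\<^sub>M D"
  using indep by (auto simp: indep_vars_def)

lemma X_space: "j \<in> J \<Longrightarrow> \<omega> \<in> space M \<Longrightarrow> X j \<omega> \<in> space D"
  using X_rv by (rule measurable_space)

lemma X_law: "j \<in> J \<Longrightarrow> distr M D (X j) = D"
  using \<zeta>_law \<xi>_law by auto

text \<open>The gradient of \<open>F\<close> is the mean of the sampled gradients, and the norm of a
  mean is at most the mean of the norms.\<close>

lemma smooth_F: "smooth L F"
  unfolding smooth_def
proof (intro allI)
  fix w w'
  have "gradient F w - gradient F w' = (\<integral>s. gradient (f s) w - gradient (f s) w' \<partial>D)"
    using grad_int by (simp add: grad_F)
  also have "norm \<dots> \<le> (\<integral>s. norm (gradient (f s) w - gradient (f s) w') \<partial>D)"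
    by (rule integral_norm_bound)
  also have "\<dots> \<le> (\<integral>s. L * norm (w - w') \<partial>D)"
    using grad_int f_smooth by (intro integral_mono) (auto simp: smooth_def)
  finally show "norm (gradient F w - gradient F w') \<le> L * norm (w - w')"
    by (simp add: D.prob_space)
qed

lemma grad_meas: "(\<lambda>(s, w). gradient (f s) w) \<in> borel_measurable (D \<Otimes>\<^sub>M borel)"
proof (rule borel_measurable_caratheodory)
  show "(\<lambda>s. gradient (f s) w) \<in> borel_measurable D" for w
    using grad_int by (rule borel_measurable_integrable)
  show "continuous_on UNIV (gradient (f s))" if "s \<in> space D" for s
    using f_smooth[OF that] by (rule smooth_continuous_on)
qed

lemma grad_comp_meas:
  assumes "g \<in> N \<rightarrow>\<^sub>M D" "u \<in> borel_measurable N"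
  shows "(\<lambda>y. gradient (f (g y)) (u y)) \<in> borel_measurable N"
  using measurable_compose[OF measurable_Pair[OF assms] grad_meas] by simp

lemma grad_F_meas: "gradient F \<in> borel_measurable borel"
  by (intro borel_measurable_continuous_onI smooth_continuous_on[OF smooth_F])

text \<open>The gradient is split at its value in \<open>w_star\<close>, and the difference is
  bounded by the Bregman gap. The linear term of that gap is kept because it disappears only after
  integration.\<close>

lemma grad_sq_le:
  assumes s: "s \<in> space D"
  shows "(norm (gradient (f s) w))\<^sup>2 \<le> 4 * L * (f s w - f s w_star - inner (w - w_star) (gradient (f s) w_star))
    + 2 * (norm (gradient (f s) w_star))\<^sup>2"
proof -
  have "(norm (gradient (f s) w))\<^sup>2
      \<le> 2 * (norm (gradient (f s) w - gradient (f s) w_star))\<^sup>2 + 2 * (norm (gradient (f s) w_star))\<^sup>2"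
    using norm_add_sq_le[of "gradient (f s) w - gradient (f s) w_star" "gradient (f s) w_star"] by simp
  moreover have "(norm (gradient (f s) w - gradient (f s) w_star))\<^sup>2
      \<le> 2 * L * (f s w - f s w_star - inner (w - w_star) (gradient (f s) w_star))"
    using convex_smooth_lower_bound[OF f_diff[OF s] f_convex[OF s] f_smooth[OF s] L_pos, where x = w_star and y = w] L_pos
    by (simp add: field_simps)
  ultimately show ?thesis
    by linarith
qed

text \<open>The majorant of \<open>grad_sq_le\<close> spreads square integrability from
  \<open>w_star\<close> to every point.\<close>

lemma grad_sq_int: "integrable D (\<lambda>s. (norm (gradient (f s) w))\<^sup>2)"
proof (rule Bochner_Integration.integrable_bound)
  show "integrable D (\<lambda>s. 4 * L * (f s w - f s w_star - inner (w - w_star) (gradient (f s) w_star))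
      + 2 * (norm (gradient (f s) w_star))\<^sup>2)"
    using grad_sq_int_star f_int grad_int by simp
  show "(\<lambda>s. (norm (gradient (f s) w))\<^sup>2) \<in> borel_measurable D"
    using borel_measurable_integrable[OF grad_int] by measurable
  show "AE s in D. norm ((norm (gradient (f s) w))\<^sup>2)
      \<le> norm (4 * L * (f s w - f s w_star - inner (w - w_star) (gradient (f s) w_star))
        + 2 * (norm (gradient (f s) w_star))\<^sup>2)"
    by (rule AE_I2) (use grad_sq_le in \<open>force intro: order_trans[OF _ abs_ge_self]\<close>)
qed

section \<open>The iterates as random variables\<close>

lemma WV_meas:
  shows W_meas: "{1..b} <+> {1..<t} \<subseteq> A \<Longrightarrow> W t \<in> borel_measurable (\<Pi>\<^sub>M j\<in>A. D)"
    and V_meas: "{1..b} <+> {1..t} \<subseteq> A \<Longrightarrow> V t \<in> borel_measurable (\<Pi>\<^sub>M j\<in>A. D)"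
proof (induction t)
  case 0
  { case 1 show ?case by (simp add: W_def[abs_def])
  next
    case 2
    then have "(\<lambda>y. gradient (f (y (Inl i))) w0) \<in> borel_measurable (\<Pi>\<^sub>M j\<in>A. D)" if "i \<in> {1..b}" for i
      using that by (intro grad_comp_meas measurable_component_singleton) auto
    then show ?case
      by (simp add: V_def[abs_def]) }
next
  case (Suc t)
  { case 1
    then have "{1..b} <+> {1..<t} \<subseteq> A" "{1..b} <+> {1..t} \<subseteq> A" by auto
    note [measurable] = Suc.IH(1)[OF this(1)] Suc.IH(2)[OF this(2)]
    have "(\<lambda>y. W t y - \<eta> *\<^sub>R V t y) \<in> borel_measurable (\<Pi>\<^sub>M j\<in>A. D)"
      by measurable
    then show ?case
      by (simp add: W_def[abs_def] V_def[abs_def])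
  next
    case 2
    then have A: "{1..b} <+> {1..<t} \<subseteq> A" "{1..b} <+> {1..t} \<subseteq> A" "Inr (Suc t) \<in> A" by auto
    note [measurable] = Suc.IH(1)[OF A(1)] Suc.IH(2)[OF A(2)]
    have [measurable]: "(\<lambda>y. W t y - \<eta> *\<^sub>R V t y) \<in> borel_measurable (\<Pi>\<^sub>M j\<in>A. D)"
      by measurable
    have [measurable]: "(\<lambda>y. gradient (f (y (Inr (Suc t)))) (W t y - \<eta> *\<^sub>R V t y)) \<in> borel_measurable (\<Pi>\<^sub>M j\<in>A. D)"
      "(\<lambda>y. gradient (f (y (Inr (Suc t)))) (W t y)) \<in> borel_measurable (\<Pi>\<^sub>M j\<in>A. D)"
      using A(3) by (intro grad_comp_meas measurable_component_singleton; measurable)+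
    have "(\<lambda>y. gradient (f (y (Inr (Suc t)))) (W t y - \<eta> *\<^sub>R V t y)
        - gradient (f (y (Inr (Suc t)))) (W t y) + V t y) \<in> borel_measurable (\<Pi>\<^sub>M j\<in>A. D)"
      by measurable
    then show ?case
      by (simp add: W_def[abs_def] V_def[abs_def]) }
qed

lemma restrict_meas: "A \<subseteq> J \<Longrightarrow> (\<lambda>\<omega>. \<lambda>j\<in>A. X j \<omega>) \<in> M \<rightarrow>\<^sub>M (\<Pi>\<^sub>M j\<in>A. D)"
  using X_rv by (intro measurable_restrict) auto

text \<open>\<open>S\<close> assigns a value to every index, while points of a product space are
  \<open>undefined\<close> off \<open>A\<close>. The difference is invisible as soon as
  \<open>A\<close> contains all indices that are read.\<close>

lemma W_restrict: "{1..b} <+> {1..<t} \<subseteq> A \<Longrightarrow> W t (restrict y A) = W t y"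
  unfolding W_def by (rule isarah_cong) (auto simp: subset_iff Plus_def)

lemma V_restrict: "{1..b} <+> {1..t} \<subseteq> A \<Longrightarrow> V t (restrict y A) = V t y"
  unfolding V_def by (rule isarah_cong) (auto simp: subset_iff Plus_def)

lemma V_Suc: "V (Suc t) y = gradient (f (y (Inr (Suc t)))) (W (Suc t) y) - gradient (f (y (Inr (Suc t)))) (W t y) + V t y"
  by (simp add: V_def W_def)

lemma W_rv[measurable]: "(\<lambda>\<omega>. W t (S \<omega>)) \<in> borel_measurable M"
proof -
  have A: "{1..b} <+> {1..<t} \<subseteq> J" by auto
  show ?thesis
    using measurable_compose[OF restrict_meas[OF subset_refl] W_meas[OF A]] unfolding W_restrict[OF A] .
qed

lemma V_rv[measurable]: "(\<lambda>\<omega>. V t (S \<omega>)) \<in> borel_measurable M"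
proof -
  have A: "{1..b} <+> {1..t} \<subseteq> J" by auto
  show ?thesis
    using measurable_compose[OF restrict_meas[OF subset_refl] V_meas[OF A]] unfolding V_restrict[OF A] .
qed

lemma V_err_rv[measurable]: "(\<lambda>\<omega>. V_err t (S \<omega>)) \<in> borel_measurable M"
  unfolding V_err_def using grad_F_meas by measurable

text \<open>The error changes by \<open>d - \<delta>\<close>, which is centered given the past. The
  martingale identity therefore applies, and its nonnegative \<delta> term is dropped.\<close>

lemma nn_integral_V_err_step:
  "(\<integral>\<^sup>+\<omega>. ennreal ((norm (V_err (Suc t) (S \<omega>)))\<^sup>2) \<partial>M)
    \<le> (\<integral>\<^sup>+\<omega>. ennreal ((norm (V_err t (S \<omega>)))\<^sup>2) \<partial>M)
      + (\<integral>\<^sup>+\<omega>. ennreal ((norm (V (Suc t) (S \<omega>) - V t (S \<omega>)))\<^sup>2) \<partial>M)"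
proof -
  \<comment> \<open>The past contains every sample that determines \<open>V t\<close>,
    \<open>W t\<close> and \<open>W (Suc t)\<close>, and just misses the sample \<open>k\<close> of
    the coming step.\<close>
  define A where "A = {1..b} <+> {1..<Suc t}"
  define k :: "nat + nat" where "k = Inr (Suc t)"
  define d where "d p s = gradient (f s) (W (Suc t) p) - gradient (f s) (W t p)" for p s
  define \<delta> where "\<delta> p = gradient F (W (Suc t) p) - gradient F (W t p)" for p
  have A: "{1..b} <+> {1..<t} \<subseteq> A" "{1..b} <+> {1..t} \<subseteq> A" "{1..b} <+> {1..<Suc t} \<subseteq> A"
    by (auto simp: A_def)
  have AJ: "A \<subseteq> J" "k \<in> J" "k \<notin> A"
    by (auto simp: A_def k_def)
  note meas[measurable] = W_meas[OF A(1)] W_meas[OF A(3)] V_meas[OF A(2)] grad_F_meas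
  have restr: "W t (\<lambda>j\<in>A. X j \<omega>) = W t (S \<omega>)" "W (Suc t) (\<lambda>j\<in>A. X j \<omega>) = W (Suc t) (S \<omega>)"
    "V t (\<lambda>j\<in>A. X j \<omega>) = V t (S \<omega>)" for \<omega>
    using W_restrict[OF A(1)] W_restrict[OF A(3)] V_restrict[OF A(2)] by auto
  have d_eq: "d (\<lambda>j\<in>A. X j \<omega>) (X k \<omega>) = V (Suc t) (S \<omega>) - V t (S \<omega>)" for \<omega>
    unfolding d_def restr by (simp add: V_Suc k_def)
  have e_eq: "V_err t (\<lambda>j\<in>A. X j \<omega>) = V_err t (S \<omega>)" for \<omega>
    unfolding V_err_def restr ..
  have sum_eq: "V_err t (\<lambda>j\<in>A. X j \<omega>) + (d (\<lambda>j\<in>A. X j \<omega>) (X k \<omega>) - \<delta> (\<lambda>j\<in>A. X j \<omega>)) = V_err (Suc t) (S \<omega>)" for \<omega>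
    unfolding d_eq unfolding V_err_def \<delta>_def restr by simp
  have d_meas: "(\<lambda>(p, s). d p s) \<in> borel_measurable ((\<Pi>\<^sub>M j\<in>A. D) \<Otimes>\<^sub>M D)"
    unfolding d_def split_beta' by (intro borel_measurable_diff grad_comp_meas; measurable)
  have d_int: "integrable D (d p)" for p
    unfolding d_def using grad_int by simp
  \<comment> \<open>With the past \<open>p\<close> fixed, smoothness bounds the increment uniformly
    in \<open>s\<close>.\<close>
  have d_int2: "integrable D (\<lambda>s. (norm (d p s))\<^sup>2)" for p
  proof (rule D.integrable_const_bound[where B = "(L * norm (W (Suc t) p - W t p))\<^sup>2"])
    show "AE s in D. norm ((norm (d p s))\<^sup>2) \<le> (L * norm (W (Suc t) p - W t p))\<^sup>2"
      using f_smooth by (intro AE_I2) (auto simp: d_def smooth_def intro!: power_mono)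
    show "(\<lambda>s. (norm (d p s))\<^sup>2) \<in> borel_measurable D"
      using borel_measurable_integrable[OF d_int] by measurable
  qed
  let ?P = "\<lambda>\<omega>. \<lambda>j\<in>A. X j \<omega>"
  have "(\<integral>\<^sup>+\<omega>. ennreal ((norm (V_err t (?P \<omega>) + (d (?P \<omega>) (X k \<omega>) - \<delta> (?P \<omega>))))\<^sup>2) \<partial>M)
      + (\<integral>\<^sup>+\<omega>. ennreal ((norm (\<delta> (?P \<omega>)))\<^sup>2) \<partial>M)
    = (\<integral>\<^sup>+\<omega>. ennreal ((norm (V_err t (?P \<omega>)))\<^sup>2) \<partial>M)
      + (\<integral>\<^sup>+\<omega>. ennreal ((norm (d (?P \<omega>) (X k \<omega>)))\<^sup>2) \<partial>M)"
  proof (rule nn_integral_sq_norm_martingale_step[OF D.prob_space_axioms indep AJ X_law[OF AJ(2)]])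
    show "V_err t \<in> borel_measurable (\<Pi>\<^sub>M j\<in>A. D)"
      unfolding V_err_def[abs_def] by measurable
    show "\<delta> p = (\<integral>s. d p s \<partial>D)" for p
      unfolding \<delta>_def d_def using grad_int by (simp add: grad_F)
  qed (rule d_meas d_int d_int2)+
  then show ?thesis
    unfolding sum_eq unfolding d_eq e_eq by (rule order_trans[OF _ eq_refl, rotated]) simp
qed

section \<open>Second moments of the mini-batch mean\<close>

lemma variance0_nonneg: "variance0 \<ge> 0"
proof -
  define a where "a = (\<integral>s. (norm (gradient (f s) w0))\<^sup>2 \<partial>D)"
  have "ennreal ((norm (gradient F w0))\<^sup>2)
      \<le> (\<integral>\<^sup>+s. ennreal ((norm (0 + (gradient (f s) w0 - gradient F w0)))\<^sup>2) \<partial>D) + ennreal ((norm (gradient F w0))\<^sup>2)"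
    by (rule add_increasing) simp_all
  also have "\<dots> = ennreal a"
    using D.nn_integral_sq_norm_centered[OF grad_int[of w0] grad_sq_int[of w0], of 0]
    by (simp add: grad_F a_def nn_integral_eq_integral[OF grad_sq_int])
  finally have "ennreal ((norm (gradient F w0))\<^sup>2) \<le> ennreal a" .
  moreover have "a \<ge> 0"
    by (simp add: a_def)
  ultimately show ?thesis
    by (simp add: variance0_def a_def)
qed

text \<open>The shift \<open>c = 0\<close> yields the second moment of \<open>e\<^sub>0\<close>, and \<open>c = b \<nabla>F(w\<^sub>0)\<close> that of \<open>v\<^sub>0\<close>.\<close>

lemma nn_integral_sq_norm_batch_sum:
  assumes "n \<le> b"
  shows "(\<integral>\<^sup>+\<omega>. ennreal ((norm (c + (\<Sum>i=1..n. gradient (f (\<zeta> i \<omega>)) w0 - gradient F w0)))\<^sup>2) \<partial>M)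
    = ennreal ((norm c)\<^sup>2 + real n * variance0)"
  using assms
proof (induction n)
  case 0
  then show ?case by (simp add: emeasure_space_1)
next
  case (Suc n)
  define \<mu> where "\<mu> = gradient F w0"
  define a where "a = (\<integral>s. (norm (gradient (f s) w0))\<^sup>2 \<partial>D)"
  have var: "variance0 = a - (norm \<mu>)\<^sup>2"
    by (simp add: variance0_def a_def \<mu>_def)
  define A :: "(nat + nat) set" where "A = Inl ` {1..n}"
  define e where "e p = c + (\<Sum>i=1..n. gradient (f (p (Inl i))) w0 - \<mu>)" for p :: "nat + nat \<Rightarrow> 's"
  have AJ: "A \<subseteq> J" "Inl (Suc n) \<in> J" "Inl (Suc n) \<notin> A"
    using Suc.prems by (auto simp: A_def)
  have e_eq: "e (\<lambda>j\<in>A. X j \<omega>) = c + (\<Sum>i=1..n. gradient (f (\<zeta> i \<omega>)) w0 - \<mu>)" for \<omega>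
    by (simp add: e_def A_def)
  have sum_eq: "e (\<lambda>j\<in>A. X j \<omega>) + (gradient (f (X (Inl (Suc n)) \<omega>)) w0 - \<mu>)
      = c + (\<Sum>i=1..Suc n. gradient (f (\<zeta> i \<omega>)) w0 - \<mu>)" for \<omega>
    unfolding e_eq by simp
  \<comment> \<open>The new gradient ignores the past, so its conditional mean is the constant \<mu>
    and each sample contributes one \<open>variance0\<close>.\<close>
  let ?P = "\<lambda>\<omega>. \<lambda>j\<in>A. X j \<omega>" and ?d = "\<lambda>p s. gradient (f s) w0"
  have "(\<integral>\<^sup>+\<omega>. ennreal ((norm (e (?P \<omega>) + (?d (?P \<omega>) (X (Inl (Suc n)) \<omega>) - \<mu>)))\<^sup>2) \<partial>M)
      + (\<integral>\<^sup>+\<omega>. ennreal ((norm \<mu>)\<^sup>2) \<partial>M)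
    = (\<integral>\<^sup>+\<omega>. ennreal ((norm (e (?P \<omega>)))\<^sup>2) \<partial>M)
      + (\<integral>\<^sup>+\<omega>. ennreal ((norm (?d (?P \<omega>) (X (Inl (Suc n)) \<omega>)))\<^sup>2) \<partial>M)"
  proof (rule nn_integral_sq_norm_martingale_step[OF D.prob_space_axioms indep AJ X_law[OF AJ(2)], where d = ?d])
    have "(\<lambda>y. gradient (f (y (Inl i))) w0) \<in> borel_measurable (\<Pi>\<^sub>M j\<in>A. D)" if "i \<in> {1..n}" for i
      using that by (intro grad_comp_meas measurable_component_singleton) (auto simp: A_def)
    then show "e \<in> borel_measurable (\<Pi>\<^sub>M j\<in>A. D)"
      unfolding e_def[abs_def] by (intro borel_measurable_add borel_measurable_sum borel_measurable_diff) auto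
    show "(\<lambda>(p, s). gradient (f s) w0) \<in> borel_measurable ((\<Pi>\<^sub>M j\<in>A. D) \<Otimes>\<^sub>M D)"
      unfolding split_beta' by (intro grad_comp_meas) auto
  qed (simp_all add: grad_int grad_sq_int grad_F \<mu>_def)
  note this[unfolded sum_eq, unfolded e_eq]
  moreover have [measurable]: "(\<lambda>s. gradient (f s) w0) \<in> borel_measurable D"
    using grad_int by (rule borel_measurable_integrable)
  moreover have "(\<integral>\<^sup>+\<omega>. ennreal ((norm (gradient (f (X (Inl (Suc n)) \<omega>)) w0))\<^sup>2) \<partial>M) = ennreal a"
  proof -
    have "(\<integral>\<^sup>+\<omega>. ennreal ((norm (gradient (f (X (Inl (Suc n)) \<omega>)) w0))\<^sup>2) \<partial>M)
        = (\<integral>\<^sup>+s. ennreal ((norm (gradient (f s) w0))\<^sup>2) \<partial>distr M D (X (Inl (Suc n))))"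
      by (subst nn_integral_distr[OF X_rv[OF AJ(2)]]) simp_all
    also have "\<dots> = ennreal a"
      unfolding X_law[OF AJ(2)] a_def by (rule nn_integral_eq_integral[OF grad_sq_int]) simp
    finally show ?thesis .
  qed
  moreover have "(\<integral>\<^sup>+\<omega>. ennreal ((norm \<mu>)\<^sup>2) \<partial>M) = ennreal ((norm \<mu>)\<^sup>2)"
    by (simp add: emeasure_space_1)
  ultimately have "(\<integral>\<^sup>+\<omega>. ennreal ((norm (c + (\<Sum>i=1..Suc n. gradient (f (\<zeta> i \<omega>)) w0 - \<mu>)))\<^sup>2) \<partial>M) + ennreal ((norm \<mu>)\<^sup>2)
     = ennreal ((norm c)\<^sup>2 + real n * variance0) + ennreal a"
    using Suc by (simp add: \<mu>_def)
  also have "\<dots> = ennreal ((norm c)\<^sup>2 + real (Suc n) * variance0) + ennreal ((norm \<mu>)\<^sup>2)"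
  proof -
    show ?thesis
      using var variance0_nonneg by (simp add: ennreal_plus[symmetric] a_def algebra_simps del: ennreal_plus)
  qed
  \<comment> \<open>The common summand is finite and hence cancels in
    \<open>ennreal\<close>.\<close>
  finally show ?case
    by (simp add: \<mu>_def add.commute ennreal_add_left_cancel)
qed

lemma nn_integral_sq_norm_batch_mean:
  "(\<integral>\<^sup>+\<omega>. ennreal ((norm ((1 / real b) *\<^sub>R (c + (\<Sum>i=1..b. gradient (f (\<zeta> i \<omega>)) w0 - gradient F w0))))\<^sup>2) \<partial>M)
    = ennreal ((norm c)\<^sup>2 / (real b)\<^sup>2 + variance0 / real b)"
proof -
  have [measurable]: "(\<lambda>\<omega>. gradient (f (\<zeta> i \<omega>)) w0) \<in> borel_measurable M" if "i \<in> {1..b}" for i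
    using X_rv[OF InlI[OF that]] by (intro grad_comp_meas) auto
  have "(\<integral>\<^sup>+\<omega>. ennreal ((norm ((1 / real b) *\<^sub>R (c + (\<Sum>i=1..b. gradient (f (\<zeta> i \<omega>)) w0 - gradient F w0))))\<^sup>2) \<partial>M)
      = (\<integral>\<^sup>+\<omega>. ennreal ((1 / real b)\<^sup>2)
          * ennreal ((norm (c + (\<Sum>i=1..b. gradient (f (\<zeta> i \<omega>)) w0 - gradient F w0)))\<^sup>2) \<partial>M)"
    by (intro nn_integral_cong) (simp add: power_mult_distrib power_divide ennreal_mult''[symmetric])
  also have "\<dots> = ennreal ((1 / real b)\<^sup>2) * ennreal ((norm c)\<^sup>2 + real b * variance0)"
    by (subst nn_integral_cmult, measurable) (simp only: nn_integral_sq_norm_batch_sum[OF order_refl])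
  also have "\<dots> = ennreal ((norm c)\<^sup>2 / (real b)\<^sup>2 + variance0 / real b)"
    using variance0_nonneg b_pos by (subst ennreal_mult''[symmetric]) (simp_all add: field_simps power2_eq_square)
  finally show ?thesis .
qed

lemma V_0: "V 0 (S \<omega>) = (1 / real b) *\<^sub>R (real b *\<^sub>R gradient F w0 + (\<Sum>i=1..b. gradient (f (\<zeta> i \<omega>)) w0 - gradient F w0))"
  by (simp add: V_def sum_subtractf sum_constant_scaleR)

lemma nn_integral_sq_norm_V_0:
  "(\<integral>\<^sup>+\<omega>. ennreal ((norm (V 0 (S \<omega>)))\<^sup>2) \<partial>M) = ennreal ((norm (gradient F w0))\<^sup>2 + variance0 / real b)"
  unfolding V_0 nn_integral_sq_norm_batch_mean using b_pos by (simp add: power_mult_distrib)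

lemma nn_integral_sq_norm_V_err_0:
  "(\<integral>\<^sup>+\<omega>. ennreal ((norm (V_err 0 (S \<omega>)))\<^sup>2) \<partial>M) = ennreal (variance0 / real b)"
proof -
  have "V_err 0 (S \<omega>) = (1 / real b) *\<^sub>R (0 + (\<Sum>i=1..b. gradient (f (\<zeta> i \<omega>)) w0 - gradient F w0))" for \<omega>
    unfolding V_err_def V_0 using b_pos by (simp add: W_def scaleR_add_right)
  then show ?thesis
    by (simp only: nn_integral_sq_norm_batch_mean) simp
qed

text \<open>The initial error plus the telescoped increments, the latter expressed through the
  second moment of \<open>V 0\<close>. It does not depend on time.\<close>

definition err_bound :: real where
  "err_bound = variance0 / real b
    + \<eta> * L / (2 - \<eta> * L) * ((norm (gradient F w0))\<^sup>2 + variance0 / real b)"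

text \<open>The error steps are added up and the increments gathered under one integral, since the
  bound by \<open>V 0\<close> holds for their sum along a run and not for each expectation
  alone.\<close>

lemma nn_integral_sq_norm_V_err:
  "(\<integral>\<^sup>+\<omega>. ennreal ((norm (V_err t (S \<omega>)))\<^sup>2) \<partial>M) \<le> ennreal err_bound"
proof -
  let ?d = "\<lambda>j \<omega>. (norm (V (Suc j) (S \<omega>) - V j (S \<omega>)))\<^sup>2"
  define c where "c = \<eta> * L / (2 - \<eta> * L)"
  have c: "c \<ge> 0"
    using \<eta>_pos L_pos \<eta>_L by (simp add: c_def)
  have "(\<integral>\<^sup>+\<omega>. ennreal ((norm (V_err t (S \<omega>)))\<^sup>2) \<partial>M)
      \<le> ennreal (variance0 / real b) + (\<Sum>j<t. \<integral>\<^sup>+\<omega>. ennreal (?d j \<omega>) \<partial>M)"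
  proof (induction t)
    case 0
    then show ?case by (simp add: nn_integral_sq_norm_V_err_0)
  next
    case (Suc t)
    then show ?case
      using order_trans[OF nn_integral_V_err_step[of t] add_right_mono[OF Suc]] by (simp add: add.assoc)
  qed
  also have "(\<Sum>j<t. \<integral>\<^sup>+\<omega>. ennreal (?d j \<omega>) \<partial>M) = (\<integral>\<^sup>+\<omega>. (\<Sum>j<t. ennreal (?d j \<omega>)) \<partial>M)"
    by (rule nn_integral_sum[symmetric]) measurable
  also have "\<dots> \<le> (\<integral>\<^sup>+\<omega>. ennreal c * ennreal ((norm (V 0 (S \<omega>)))\<^sup>2) \<partial>M)"
  proof (rule nn_integral_mono)
    fix \<omega> assume "\<omega> \<in> space M"
    then have "\<xi> t \<omega> \<in> space D" if "t \<ge> 1" for t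
      using X_space[of "Inr t" \<omega>] that by auto
    then have "(\<Sum>j<t. ?d j \<omega>) \<le> c * (norm (V 0 (S \<omega>)))\<^sup>2"
      unfolding V_def c_def using f_diff f_convex f_smooth L_pos \<eta>_pos \<eta>_L
      by (intro sum_sq_isarah_v_diff_le) auto
    then show "(\<Sum>j<t. ennreal (?d j \<omega>)) \<le> ennreal c * ennreal ((norm (V 0 (S \<omega>)))\<^sup>2)"
      using c by (simp add: sum_ennreal ennreal_mult[symmetric] ennreal_leI)
  qed
  also have "\<dots> = ennreal c * ennreal ((norm (gradient F w0))\<^sup>2 + variance0 / real b)"
    by (subst nn_integral_cmult) (simp_all add: nn_integral_sq_norm_V_0)
  also have "ennreal (variance0 / real b) + \<dots> = ennreal err_bound"
    using c variance0_nonneg unfolding err_bound_def c_def[symmetric]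
    by (simp add: ennreal_mult[symmetric] ennreal_plus[symmetric] del: ennreal_plus)
  finally show ?thesis
    by (simp add: add_left_mono)
qed

section \<open>From nonnegative integrals to expectations of squared errors and gradients\<close>

lemma V_err_sq:
  shows integrable_V_err_sq: "integrable M (\<lambda>\<omega>. (norm (V_err t (S \<omega>)))\<^sup>2)"
    and expectation_V_err_sq: "expectation (\<lambda>\<omega>. (norm (V_err t (S \<omega>)))\<^sup>2) \<le> err_bound"
proof -
  have nonneg: "err_bound \<ge> 0"
    using \<eta>_pos L_pos \<eta>_L variance0_nonneg by (simp add: err_bound_def)
  show "integrable M (\<lambda>\<omega>. (norm (V_err t (S \<omega>)))\<^sup>2)"
    using le_less_trans[OF nn_integral_sq_norm_V_err ennreal_less_top]
    by (intro integrableI_nonneg) auto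
  show "expectation (\<lambda>\<omega>. (norm (V_err t (S \<omega>)))\<^sup>2) \<le> err_bound"
    using nn_integral_sq_norm_V_err nonneg
    by (subst integral_eq_nn_integral) (auto intro: enn2real_leI)
qed

lemma gradient_W_sq:
  shows integrable_gradient_W_sq: "integrable M (\<lambda>\<omega>. (norm (gradient F (W t (S \<omega>))))\<^sup>2)"
    and sum_expectation_gradient_W_sq: "(\<Sum>t\<le>m. expectation (\<lambda>\<omega>. (norm (gradient F (W t (S \<omega>))))\<^sup>2))
      \<le> 2 / \<eta> * (F w0 - F w_star) + real (m + 1) * err_bound"
proof -
  have le: "(\<Sum>t\<le>n. (norm (gradient F (W t (S \<omega>))))\<^sup>2)
      \<le> 2 / \<eta> * (F w0 - F w_star) + (\<Sum>t\<le>n. (norm (V_err t (S \<omega>)))\<^sup>2)" for n \<omega>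
    unfolding W_def V_def V_err_def by (rule sum_sq_gradient_le[OF F_diff smooth_F F_min \<eta>_pos \<eta>_L])
  have int_rhs: "integrable M (\<lambda>\<omega>. 2 / \<eta> * (F w0 - F w_star) + (\<Sum>t\<le>n. (norm (V_err t (S \<omega>)))\<^sup>2))" for n
    using integrable_V_err_sq by (intro Bochner_Integration.integrable_add Bochner_Integration.integrable_sum) auto
  \<comment> \<open>One squared gradient is at most the sum up to \<open>t\<close>, so
    \<open>le\<close> supplies an integrable majorant.\<close>
  have int: "integrable M (\<lambda>\<omega>. (norm (gradient F (W t (S \<omega>))))\<^sup>2)" for t
  proof (rule Bochner_Integration.integrable_bound[OF int_rhs[of t]])
    show "(\<lambda>\<omega>. (norm (gradient F (W t (S \<omega>))))\<^sup>2) \<in> borel_measurable M"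
      using grad_F_meas by measurable
    show "AE \<omega> in M. norm ((norm (gradient F (W t (S \<omega>))))\<^sup>2)
        \<le> norm (2 / \<eta> * (F w0 - F w_star) + (\<Sum>t\<le>t. (norm (V_err t (S \<omega>)))\<^sup>2))"
    proof (rule AE_I2)
      fix \<omega>
      have "(norm (gradient F (W t (S \<omega>))))\<^sup>2 \<le> (\<Sum>t\<le>t. (norm (gradient F (W t (S \<omega>))))\<^sup>2)"
        by (rule member_le_sum) auto
      with le[of \<omega> t]
      show "norm ((norm (gradient F (W t (S \<omega>))))\<^sup>2)
        \<le> norm (2 / \<eta> * (F w0 - F w_star) + (\<Sum>t\<le>t. (norm (V_err t (S \<omega>)))\<^sup>2))"
        by simp
    qed
  qed
  then show "integrable M (\<lambda>\<omega>. (norm (gradient F (W t (S \<omega>))))\<^sup>2)" .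
  have "(\<Sum>t\<le>m. expectation (\<lambda>\<omega>. (norm (gradient F (W t (S \<omega>))))\<^sup>2))
      = expectation (\<lambda>\<omega>. \<Sum>t\<le>m. (norm (gradient F (W t (S \<omega>))))\<^sup>2)"
    using int by (intro Bochner_Integration.integral_sum[symmetric])
  also have "\<dots> \<le> expectation (\<lambda>\<omega>. 2 / \<eta> * (F w0 - F w_star) + (\<Sum>t\<le>m. (norm (V_err t (S \<omega>)))\<^sup>2))"
    by (intro integral_mono le int_rhs Bochner_Integration.integrable_sum int)
  also have "\<dots> = 2 / \<eta> * (F w0 - F w_star) + (\<Sum>t\<le>m. expectation (\<lambda>\<omega>. (norm (V_err t (S \<omega>)))\<^sup>2))"
    using integrable_V_err_sq
    by (simp add: Bochner_Integration.integral_add Bochner_Integration.integral_sum prob_space)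
  also have "(\<Sum>t\<le>m. expectation (\<lambda>\<omega>. (norm (V_err t (S \<omega>)))\<^sup>2)) \<le> (\<Sum>t\<le>m. err_bound)"
    by (intro sum_mono expectation_V_err_sq)
  finally show "(\<Sum>t\<le>m. expectation (\<lambda>\<omega>. (norm (gradient F (W t (S \<omega>))))\<^sup>2))
      \<le> 2 / \<eta> * (F w0 - F w_star) + real (m + 1) * err_bound"
    by simp
qed

text \<open>The integral of \<open>grad_sq_le\<close> at \<open>w0\<close>: the linear term has mean
  zero because the gradient of \<open>F\<close> vanishes at the minimizer.\<close>

lemma variance0_le:
  "variance0 + (norm (gradient F w0))\<^sup>2
    \<le> 4 * L * (F w0 - F w_star) + 2 * (\<integral>s. (norm (gradient (f s) w_star))\<^sup>2 \<partial>D)"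
proof -
  have "gradient F w_star = 0"
    using gradient_norm_le_gap[OF F_diff smooth_F L_pos F_min, of w_star] by simp
  have "variance0 + (norm (gradient F w0))\<^sup>2 = (\<integral>s. (norm (gradient (f s) w0))\<^sup>2 \<partial>D)"
    by (simp add: variance0_def)
  also have "\<dots> \<le> (\<integral>s. 4 * L * (f s w0 - f s w_star - inner (w0 - w_star) (gradient (f s) w_star))
      + 2 * (norm (gradient (f s) w_star))\<^sup>2 \<partial>D)"
    using f_int grad_int grad_sq_int grad_sq_le by (intro integral_mono) auto
  also have "\<dots> = 4 * L * (F w0 - F w_star) + 2 * (\<integral>s. (norm (gradient (f s) w_star))\<^sup>2 \<partial>D)"
    using f_int grad_int grad_sq_int by (simp add: F_eq grad_F \<open>gradient F w_star = 0\<close>)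
  finally show ?thesis .
qed

end


section \<open>Specialization of the step size and the batch size\<close>

theorem theorem1:
  fixes D :: "'s measure"
    and f :: "'s \<Rightarrow> real ^ 'd \<Rightarrow> real"
    and F :: "real ^ 'd \<Rightarrow> real"
    and w0 w_star :: "real ^ 'd"
    and L \<sigma>_star \<eta> :: real
    and m b :: nat
    and M :: "'o measure"
    and \<zeta> \<xi> :: "nat \<Rightarrow> 'o \<Rightarrow> 's"
    and \<tau> :: "'o \<Rightarrow> nat"
  assumes "prob_space D"
    and "\<And>s w. s \<in> space D \<Longrightarrow> f s differentiable (at w)"
    and "\<And>w. integrable D (\<lambda>s. f s w)"
    and "\<And>w. F w = (\<integral>s. f s w \<partial>D)"
    and "bdd_below (range F)"
    and "\<And>w. F differentiable (at w)"
    and "\<And>w. integrable D (\<lambda>s. gradient (f s) w)"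
    and "\<And>w. (\<integral>s. gradient (f s) w \<partial>D) = gradient F w"
    and "L > 0"
    and "\<And>s. s \<in> space D \<Longrightarrow> convex_on UNIV (f s)"
    and "\<And>s. s \<in> space D \<Longrightarrow> smooth L (f s)"
    and "\<And>w. F w_star \<le> F w"
    and "\<sigma>_star > 0"
    and "integrable D (\<lambda>s. (norm (gradient (f s) w_star))\<^sup>2)"
    and "(\<integral>s. (norm (gradient (f s) w_star))\<^sup>2 \<partial>D) \<le> \<sigma>_star\<^sup>2"
    and "m \<ge> 1"
    and "real b = 2 * sqrt (real m + 1)"
    and "\<eta> = 1 / (L * sqrt (real m + 1))"
    and "isarah_sampling M D m b \<zeta> \<xi> \<tau>"
  shows "integrable M (\<lambda>\<omega>. (norm (gradient F (isarah_in f w0 \<eta> b \<zeta> \<xi> \<tau> \<omega>)))\<^sup>2) \<and>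
    (\<integral>\<omega>. (norm (gradient F (isarah_in f w0 \<eta> b \<zeta> \<xi> \<tau> \<omega>)))\<^sup>2 \<partial>M)
      \<le> 1 / sqrt (real m + 1) * (6 * L * (F w0 - F w_star) + 2 * \<sigma>_star\<^sup>2)"
proof -
  define r where "r = sqrt (real m + 1)"
  have r: "r \<ge> 1" "r\<^sup>2 = real (m + 1)"
    by (simp_all add: r_def)
  have b: "real b = 2 * r" and \<eta>: "\<eta> = 1 / (L * r)"
    using assms by (simp_all add: r_def)
  have "b > 0"
    using b r(1) by linarith
  have step_size: "\<eta> * L = 1 / r"
    using assms(9) by (simp add: \<eta>)
  have "\<eta> > 0" "\<eta> * L \<le> 1"
    using r(1) assms(9) unfolding step_size by (simp_all add: \<eta>)
  note sampling = assms(19)[unfolded isarah_sampling_def]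
  interpret prob_space M
    using sampling by blast
  interpret isarah M D f F w0 w_star L \<eta> b \<zeta> \<xi>
    by (intro isarah.intro isarah_axioms.intro prob_space_axioms assms \<open>b > 0\<close> \<open>\<eta> > 0\<close> \<open>\<eta> * L \<le> 1\<close>)
      (use sampling in auto)
  let ?h = "\<lambda>t y. (norm (gradient F (W t y)))\<^sup>2"
  let ?Y = "\<lambda>\<omega>. \<lambda>j\<in>J. X j \<omega>"
  have J: "{1..b} <+> {1..<t} \<subseteq> J" for t
    by auto
  have h_Y: "?h t (?Y \<omega>) = ?h t (S \<omega>)" for t \<omega>
    unfolding W_restrict[OF J] ..
  have out: "W (\<tau> \<omega>) (S \<omega>) = isarah_in f w0 \<eta> b \<zeta> \<xi> \<tau> \<omega>" for \<omega>
    by (simp add: W_def isarah_in_def)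
  have law: "distr M (count_space UNIV) \<tau> = measure_pmf (pmf_of_set {0..m})"
    and ind: "indep_rvs (count_space UNIV) \<tau> (\<Pi>\<^sub>M j\<in>J. D) ?Y"
    using sampling by auto
  have meas: "?h t \<in> borel_measurable (\<Pi>\<^sub>M j\<in>J. D)" for t
    using W_meas[OF J] grad_F_meas by measurable
  have int: "integrable M (\<lambda>\<omega>. ?h t (?Y \<omega>))" for t
    unfolding h_Y by (rule integrable_gradient_W_sq)
  \<comment> \<open>Independence of \<tau> is available for the family restricted to
    \<open>J\<close>; \<open>h_Y\<close> and \<open>out\<close> carry the conclusion over to the
    output of the algorithm.\<close>
  note average = uniform_index_expectation[where h = ?h, OF law ind meas int, unfolded h_Y out]

  define \<Delta> where "\<Delta> = F w0 - F w_star"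
  define G where "G = (norm (gradient F w0))\<^sup>2"
  have "\<Delta> \<ge> 0"
    using F_min by (simp add: \<Delta>_def)
  have var: "variance0 + G \<le> 4 * L * \<Delta> + 2 * \<sigma>_star\<^sup>2"
    using variance0_le assms(15) unfolding G_def \<Delta>_def by linarith
  \<comment> \<open>For this choice of \<open>b\<close> and \<open>\<eta>\<close> the variance and \<open>G\<close> enter with the same weight,
    so that \<open>variance0_le\<close> applies to their sum.\<close>
  have "err_bound = (variance0 + G) / (2 * r - 1)"
  proof -
    have eq: "\<eta> * L / (2 - \<eta> * L) = 1 / (2 * r - 1)"
      using r(1) unfolding step_size by (simp add: field_simps)
    show ?thesis
      using r(1) unfolding err_bound_def eq b G_def by (simp add: field_simps)
  qed
  \<comment> \<open>The denominator satisfies \<open>2 * r - 1 \<ge> r\<close> since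
    \<open>r \<ge> 1\<close>; \<Delta> \<ge> 0 keeps the new numerator nonnegative.\<close>
  also have "\<dots> \<le> (4 * L * \<Delta> + 2 * \<sigma>_star\<^sup>2) / r"
    using var r(1) \<open>\<Delta> \<ge> 0\<close> assms(9) by (intro frac_le) auto
  finally have err: "err_bound \<le> (4 * L * \<Delta> + 2 * \<sigma>_star\<^sup>2) / r" .
  have "(\<Sum>t\<le>m. expectation (\<lambda>\<omega>. ?h t (S \<omega>))) / real (m + 1)
      \<le> (2 / \<eta> * \<Delta> + real (m + 1) * err_bound) / real (m + 1)"
    using sum_expectation_gradient_W_sq[of m] unfolding \<Delta>_def by (intro divide_right_mono) auto
  \<comment> \<open>Here \<open>2 / \<eta>\<close> is \<open>2 * L * r\<close>, and division by
    \<open>m + 1\<close>, the square of \<open>r\<close>, leaves \<open>2 * L / r\<close>.\<close>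
  also have "\<dots> = 2 * L * \<Delta> / r + err_bound"
    using r(1) unfolding r(2)[symmetric] \<eta> by (simp add: add_divide_distrib power2_eq_square)
  also have "\<dots> \<le> 2 * L * \<Delta> / r + (4 * L * \<Delta> + 2 * \<sigma>_star\<^sup>2) / r"
    using err by simp
  \<comment> \<open>The factor 6 is 2 from the descent inequality plus 4 from the second moment at
    \<open>w0\<close>.\<close>
  also have "\<dots> = 1 / r * (6 * L * \<Delta> + 2 * \<sigma>_star\<^sup>2)"
    by (simp add: add_divide_distrib[symmetric])
  finally show ?thesis
    using average unfolding r_def \<Delta>_def by auto
qed

end
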